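(* Let $X$ be a path-connected ANR space, $m\ge 2$ an integer, $R$ a ring, and let $H^*$ denote Alexander–Spanier cohomology. Let $\Delta_2:SP^2(X)\to (SP^2(X))^m$ be the diagonal map and $\partial_2^m:X^m\to (SP^2(X))^m$ the $m$-fold product of the diagonal map $\partial_2:X\to SP^2(X)$. Suppose that $\alpha_i^*\in H^{k_i}((SP^2(X))^m;R)$ with $k_i\ge 1$, for $i=1,2$, are cohomology classes such that $\Delta_2^*(\alpha_i^* )=0$. If $\alpha_i\in H^{k_i}(X^m;R)$ are their images under the induced homomorphism $(\partial_2^m)^*$ and $\alpha_1\smile\alpha_2\neq 0$, then $\mathsf{iTC}_m(X)\ge 2$.
   Context: $SP^2(X)$ is the orbit space of $X\times X$ under the action of the symmetric group $S_2$ permuting coordinates; $\partial_2(x)=[x,x]$, so $\partial_2^m(x_1,\dots,x_m)=([x_1,x_1],\dots,[x_m,x_m])$. $I=[0,1]$. For a metric space $Z$ and $n\ge 1$, $\mathcal B_n(Z)$ is the space of probability measures on $Z$ whose support has at most $n$ points, written as finite formal convex combinations $\sum\lambda_z z$ with $\lambda_z>0$, $\sum\lambda_z=1$, equipped with the Lévy–Prokhorov metric; $\delta_z$ is the Dirac measure at $z$. $P(Z)$ is the space of continuous paths $I\to Z$ with the compact-open topology. Define $\Phi_n:\mathcal B_n(P(X))\to P(\mathcal B_n(X))$ by $\Phi_n(\sum\lambda_\alpha\alpha)(t)=\sum\lambda_\alpha\alpha(t)$. A path $f\in P(\mathcal B_n(X))$ is resolvable if $f=\Phi_n(\mu)$ for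 some $\mu\in\mathcal B_n(P(X))$; $RP(\mathcal B_n(X))\subset P(\mathcal B_n(X))$ is the subspace of resolvable paths. Let $t_i=(i-1)/(m-1)$, $1\le i\le m$. $\mathsf{iTC}_m(X)$ is the minimal integer $n\ge 0$ such that there is a continuous map $s_m:X^m\to RP(\mathcal B_{n+1}(X))$ with $s_m(x_1,\dots,x_m)(t_i)=\delta_{x_i}$ for all $1\le i\le m$ and all $(x_1,\dots,x_m)\in X^m$ (infinite if no such $n$ exists). *)

theory Defs
  imports
    "HOL-Probability.Probability_Mass_Function"
    "HOL-Library.Uprod"
    "HOL-Library.Extended_Nat"
    "HOL-Algebra.Coset"
begin

section \<open>Absolute neighborhood retracts\<close>

text \<open>
  A metrizable space is an ANR if each closed copy of it in a metrizable space is a retract of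
  one of its neighborhoods. HOL cannot quantify over the carrier type of the ambient space; the
  type \<open>'a \<Rightarrow> real\<close> is large enough: a metrizable space embeds as a closed subset of the
  convex hull of its Kuratowski image in the Banach space of bounded real functions on it, and a
  neighborhood retraction there yields one in every metrizable space by Dugundji's extension theorem.
\<close>

definition ANR_space :: "'a topology \<Rightarrow> bool" where
  "ANR_space X \<longleftrightarrow> metrizable_space X \<and>
    (\<forall>(Z :: ('a \<Rightarrow> real) topology) S.
       metrizable_space Z \<and> closedin Z S \<and> X homeomorphic_space subtopology Z S \<longrightarrow>
       (\<exists>W. openin Z W \<and> S \<subseteq> W \<and> S retract_of_space subtopology Z W))"


section \<open>The symmetric square\<close>

text \<open>\<open>Upair x y\<close> is the orbit of \<open>(x, y)\<close> under the swap; the topology is the quotient topology.\<close>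

definition SP2 :: "'a topology \<Rightarrow> 'a uprod topology" where
  "SP2 X = topology (\<lambda>U. U \<subseteq> (\<lambda>(x, y). Upair x y) ` (topspace X \<times> topspace X) \<and>
     openin (prod_topology X X) {p \<in> topspace X \<times> topspace X. (case p of (x, y) \<Rightarrow> Upair x y) \<in> U})"

lemma openin_SP2:
  "openin (SP2 X) U \<longleftrightarrow> U \<subseteq> (\<lambda>(x, y). Upair x y) ` (topspace X \<times> topspace X) \<and>
     openin (prod_topology X X) {p \<in> topspace X \<times> topspace X. (case p of (x, y) \<Rightarrow> Upair x y) \<in> U}"
proof -
  let ?q = "\<lambda>(x, y). Upair x y"
  let ?P = "topspace X \<times> topspace X"
  have "istopology (\<lambda>U. U \<subseteq> ?q ` ?P \<and> openin (prod_topology X X) {p \<in> ?P. ?q p \<in> U})"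
    unfolding istopology_def
  proof (intro conjI allI impI)
    fix S T assume S: "S \<subseteq> ?q ` ?P \<and> openin (prod_topology X X) {p \<in> ?P. ?q p \<in> S}"
      and T: "T \<subseteq> ?q ` ?P \<and> openin (prod_topology X X) {p \<in> ?P. ?q p \<in> T}"
    show "S \<inter> T \<subseteq> ?q ` ?P" using S by blast
    have "{p \<in> ?P. ?q p \<in> S \<inter> T} = {p \<in> ?P. ?q p \<in> S} \<inter> {p \<in> ?P. ?q p \<in> T}" by blast
    then show "openin (prod_topology X X) {p \<in> ?P. ?q p \<in> S \<inter> T}"
      using S T by (simp only: openin_Int)
  next
    fix K assume K: "\<forall>S\<in>K. S \<subseteq> ?q ` ?P \<and> openin (prod_topology X X) {p \<in> ?P. ?q p \<in> S}"
    show "\<Union>K \<subseteq> ?q ` ?P" using K by blast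
    have eq: "{p \<in> ?P. ?q p \<in> \<Union>K} = \<Union>((\<lambda>S. {p \<in> ?P. ?q p \<in> S}) ` K)" by blast
    show "openin (prod_topology X X) {p \<in> ?P. ?q p \<in> \<Union>K}"
      unfolding eq using K by (intro openin_Union) blast
  qed
  then show ?thesis
    by (simp only: SP2_def topology_inverse')
qed

definition power_space :: "nat \<Rightarrow> 'a topology \<Rightarrow> (nat \<Rightarrow> 'a) topology" where
  "power_space m X = product_topology (\<lambda>_. X) {1..m}"

definition diag :: "nat \<Rightarrow> 'a \<Rightarrow> nat \<Rightarrow> 'a" where
  "diag m z = (\<lambda>i\<in>{1..m}. z)"

definition sq_diag :: "nat \<Rightarrow> (nat \<Rightarrow> 'a) \<Rightarrow> nat \<Rightarrow> 'a uprod" where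
  "sq_diag m x = (\<lambda>i\<in>{1..m}. Upair (x i) (x i))"


section \<open>Finitely supported measures and resolvable paths\<close>

definition LP_close :: "'a::metric_space pmf \<Rightarrow> 'a pmf \<Rightarrow> real \<Rightarrow> bool" where
  "LP_close p q e \<longleftrightarrow> 0 < e \<and> (\<forall>A\<in>sets borel.
      measure_pmf.prob p A \<le> measure_pmf.prob q (\<Union>a\<in>A. ball a e) + e \<and>
      measure_pmf.prob q A \<le> measure_pmf.prob p (\<Union>a\<in>A. ball a e) + e)"

definition levy_prokhorov :: "'a::metric_space pmf \<Rightarrow> 'a pmf \<Rightarrow> real" where
  "levy_prokhorov p q = Inf (Collect (LP_close p q))"

lemma LP_close_2: "LP_close p q 2"
  unfolding LP_close_def
proof (intro conjI ballI)
  fix A :: "'a set"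
  show "measure_pmf.prob p A \<le> measure_pmf.prob q (\<Union>a\<in>A. ball a 2) + 2"
    using measure_pmf.prob_le_1[of p A] measure_nonneg[of q "\<Union>a\<in>A. ball a 2"] by linarith
  show "measure_pmf.prob q A \<le> measure_pmf.prob p (\<Union>a\<in>A. ball a 2) + 2"
    using measure_pmf.prob_le_1[of q A] measure_nonneg[of p "\<Union>a\<in>A. ball a 2"] by linarith
qed simp

lemma LP_close_bdd_below: "bdd_below (Collect (LP_close p q))"
  by (rule bdd_belowI[of _ 0]) (simp add: LP_close_def)

lemma LP_close_trans:
  assumes "LP_close p q d" and "LP_close q r e"
  shows "LP_close p r (d + e)"
proof -
  have half: "measure_pmf.prob u A \<le> measure_pmf.prob w (\<Union>a\<in>A. ball a (d + e)) + (d + e)"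
    if A: "A \<in> sets borel" and uv: "\<And>B. B \<in> sets borel \<Longrightarrow>
        measure_pmf.prob u B \<le> measure_pmf.prob v (\<Union>a\<in>B. ball a d') + d'"
      and vw: "\<And>B. B \<in> sets borel \<Longrightarrow>
        measure_pmf.prob v B \<le> measure_pmf.prob w (\<Union>a\<in>B. ball a e') + e'"
      and de: "d' + e' = d + e"
    for u v w :: "'a pmf" and A d' e'
  proof -
    let ?B = "\<Union>a\<in>A. ball a d'"
    have B: "?B \<in> sets borel" by (intro borel_open open_UN) auto
    have "(\<Union>b\<in>?B. ball b e') \<subseteq> (\<Union>a\<in>A. ball a (d' + e'))"
    proof
      fix z assume "z \<in> (\<Union>b\<in>?B. ball b e')"
      then obtain a b where "a \<in> A" "dist a b < d'" "dist b z < e'" by auto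
      then have "dist a z < d' + e'" using dist_triangle[of a z b] by linarith
      with \<open>a \<in> A\<close> show "z \<in> (\<Union>a\<in>A. ball a (d' + e'))" by auto
    qed
    then have "measure_pmf.prob w (\<Union>b\<in>?B. ball b e') \<le> measure_pmf.prob w (\<Union>a\<in>A. ball a (d' + e'))"
      by (intro measure_pmf.finite_measure_mono) auto
    with uv[OF A] vw[OF B] de show ?thesis by simp
  qed
  show ?thesis
    unfolding LP_close_def
  proof (intro conjI ballI)
    show "0 < d + e" using assms by (simp add: LP_close_def)
    fix A :: "'a set" assume A: "A \<in> sets borel"
    show "measure_pmf.prob p A \<le> measure_pmf.prob r (\<Union>a\<in>A. ball a (d + e)) + (d + e)"
      by (rule half[OF A, of p q d r e]) (use assms in \<open>auto simp: LP_close_def\<close>)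
    show "measure_pmf.prob r A \<le> measure_pmf.prob p (\<Union>a\<in>A. ball a (d + e)) + (d + e)"
      by (rule half[OF A, of r q e p d]) (use assms in \<open>auto simp: LP_close_def\<close>)
  qed
qed

lemma LP_close_mono:
  assumes "LP_close p q d" and "d \<le> e"
  shows "LP_close p q e"
proof -
  have "measure_pmf.prob r (\<Union>a\<in>A. ball a d) \<le> measure_pmf.prob r (\<Union>a\<in>A. ball a e)"
    for r :: "'a pmf" and A :: "'a set"
    using assms(2) by (intro measure_pmf.finite_measure_mono) force+
  with assms show ?thesis
    unfolding LP_close_def by (meson add_mono less_le_trans order_trans)
qed

lemma LP_close_if_levy_prokhorov_less:
  assumes "levy_prokhorov p q < e"
  shows "LP_close p q e"
proof -
  have "Collect (LP_close p q) \<noteq> {}" using LP_close_2 by blast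
  then obtain d where "LP_close p q d" "d < e"
    using assms unfolding levy_prokhorov_def by (auto simp: cInf_less_iff LP_close_bdd_below)
  then show ?thesis by (meson LP_close_mono less_imp_le)
qed

lemma levy_prokhorov_le:
  assumes "LP_close p q e"
  shows "levy_prokhorov p q \<le> e"
  unfolding levy_prokhorov_def by (rule cInf_lower) (use assms LP_close_bdd_below in auto)

lemma pmf_le_if_LP_close:
  fixes p q :: "'a::metric_space pmf"
  assumes "\<And>e. 0 < e \<Longrightarrow> LP_close p q e"
  shows "pmf p x \<le> pmf q x"
proof -
  let ?B = "\<lambda>n. ball x (inverse (real (Suc n)))"
  have "(\<lambda>n. measure_pmf.prob q (?B n)) \<longlonglongrightarrow> measure_pmf.prob q (\<Inter>n. ?B n)"
    by (rule measure_pmf.finite_Lim_measure_decseq)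
      (auto simp: decseq_def intro!: subset_ball le_imp_inverse_le)
  moreover have "(\<Inter>n. ?B n) = {x}"
  proof -
    have "y = x" if y: "\<And>n. dist x y < inverse (real (Suc n))" for y
    proof (rule ccontr)
      assume "y \<noteq> x"
      then obtain n where "inverse (real (Suc n)) < dist x y"
        using reals_Archimedean[of "dist x y"] by auto
      with y[of n] show False by simp
    qed
    then show ?thesis by auto
  qed
  ultimately have "(\<lambda>n. measure_pmf.prob q (?B n) + inverse (real (Suc n))) \<longlonglongrightarrow> pmf q x + 0"
    by (intro tendsto_add LIMSEQ_inverse_real_of_nat) (simp add: measure_pmf_single)
  moreover have "pmf p x \<le> measure_pmf.prob q (?B n) + inverse (real (Suc n))" for n
  proof -
    have "LP_close p q (inverse (real (Suc n)))" by (rule assms) simp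
    moreover have "{x} \<in> sets borel" by simp
    ultimately have "measure_pmf.prob p {x} \<le>
        measure_pmf.prob q (\<Union>a\<in>{x}. ball a (inverse (real (Suc n)))) + inverse (real (Suc n))"
      unfolding LP_close_def by blast
    then show ?thesis by (simp add: measure_pmf_single)
  qed
  ultimately show ?thesis
    by (intro LIMSEQ_le_const[of _ "pmf q x"]) auto
qed

lemma Metric_space_levy_prokhorov: "Metric_space M (levy_prokhorov :: 'a::metric_space pmf \<Rightarrow> 'a pmf \<Rightarrow> real)"
proof
  fix p q r :: "'a pmf"
  show nonneg: "0 \<le> levy_prokhorov p q" for p q :: "'a pmf"
    unfolding levy_prokhorov_def
  proof (rule cInf_greatest)
    show "Collect (LP_close p q) \<noteq> {}" using LP_close_2 by blast
  qed (simp add: LP_close_def)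
  have "LP_close p q = LP_close q p" for p q :: "'a pmf"
    unfolding LP_close_def by blast
  then show comm: "levy_prokhorov p q = levy_prokhorov q p" for p q :: "'a pmf"
    unfolding levy_prokhorov_def by simp
  show "levy_prokhorov p q = 0 \<longleftrightarrow> p = q"
  proof
    assume "levy_prokhorov p q = 0"
    then have "LP_close p q e" "LP_close q p e" if "0 < e" for e
      using that comm[of p q] by (auto intro: LP_close_if_levy_prokhorov_less)
    then show "p = q"
      by (intro pmf_eqI antisym pmf_le_if_LP_close)
  next
    assume "p = q"
    have "LP_close p p e" if "0 < e" for e
    proof -
      have "measure_pmf.prob p A \<le> measure_pmf.prob p (\<Union>a\<in>A. ball a e)" for A
        using that by (intro measure_pmf.finite_measure_mono) auto
      then show ?thesis
        unfolding LP_close_def using that by (auto intro: add_increasing2)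
    qed
    then have "levy_prokhorov p p \<le> 0 + e" if "0 < e" for e
      using that by (simp add: levy_prokhorov_le)
    then have "levy_prokhorov p p \<le> 0" by (rule field_le_epsilon)
    with nonneg[of p p] \<open>p = q\<close> show "levy_prokhorov p q = 0" by simp
  qed
  show "levy_prokhorov p r \<le> levy_prokhorov p q + levy_prokhorov q r"
  proof (rule field_le_epsilon)
    fix e :: real assume "0 < e"
    then have "LP_close p q (levy_prokhorov p q + e / 2)" "LP_close q r (levy_prokhorov q r + e / 2)"
      by (auto intro: LP_close_if_levy_prokhorov_less)
    from levy_prokhorov_le[OF LP_close_trans[OF this]]
    show "levy_prokhorov p r \<le> levy_prokhorov p q + levy_prokhorov q r + e" by simp
  qed
qed

definition Bn :: "nat \<Rightarrow> 'a::metric_space pmf topology" where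
  "Bn n = Metric_space.mtopology {p. finite (set_pmf p) \<and> card (set_pmf p) \<le> n} levy_prokhorov"

lemma topspace_Bn [simp]: "topspace (Bn n) = {p. finite (set_pmf p) \<and> card (set_pmf p) \<le> n}"
  by (simp add: Bn_def Metric_space.topspace_mtopology[OF Metric_space_levy_prokhorov])

text \<open>Paths are functions on \<open>real\<close> normalised to \<open>undefined\<close> outside the unit interval.\<close>

definition path_space :: "'a topology \<Rightarrow> (real \<Rightarrow> 'a) topology" where
  "path_space Z = topology_generated_by
     {{f \<in> extensional {0..1}. pathin Z f \<and> f ` K \<subseteq> U} | K U. K \<subseteq> {0..1} \<and> compact K \<and> openin Z U}"

lemma topspace_path_space [simp]:
  "topspace (path_space Z) = {f \<in> extensional {0..1}. pathin Z f}"
proof -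
  have "{f \<in> extensional {0..1}. pathin Z f} \<in>
     {{f \<in> extensional {0..1}. pathin Z f \<and> f ` K \<subseteq> U} | K U. K \<subseteq> {0..1} \<and> compact K \<and> openin Z U}"
    by (rule CollectI, rule exI[of _ "{}"], rule exI[of _ "{}"]) auto
  then show ?thesis
    unfolding path_space_def topology_generated_by_topspace by blast
qed

definition Phi :: "(real \<Rightarrow> 'a) pmf \<Rightarrow> real \<Rightarrow> 'a pmf" where
  "Phi \<mu> = (\<lambda>t\<in>{0..1}. map_pmf (\<lambda>\<alpha>. \<alpha> t) \<mu>)"

definition RP :: "nat \<Rightarrow> (real \<Rightarrow> 'a::metric_space pmf) topology" where
  "RP n = subtopology (path_space (Bn n))
     {Phi \<mu> | \<mu>. set_pmf \<mu> \<subseteq> topspace (path_space euclidean) \<and>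
        finite (set_pmf \<mu>) \<and> card (set_pmf \<mu>) \<le> n}"

definition iTC :: "'a::metric_space itself \<Rightarrow> nat \<Rightarrow> enat" where
  "iTC _ m = Inf {enat n | n. \<exists>s.
     continuous_map (power_space m (euclidean :: 'a topology)) (RP (n + 1)) s \<and>
     (\<forall>x \<in> topspace (power_space m (euclidean :: 'a topology)). \<forall>i\<in>{1..m}.
        s x ((real i - 1) / (real m - 1)) = return_pmf (x i))}"


section \<open>Alexander--Spanier cohomology\<close>

text \<open>
  A \<open>p\<close>-cochain is a function on \<open>(p + 1)\<close>-tuples of points, encoded as lists and extended by \<open>0\<close>.
  The cohomology is that of the complex of cochains modulo locally zero cochains. As with relative
  singular cycles in HOL-Homology, its cocycles and coboundaries are represented by their
  preimages in the group of cochains.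
\<close>

definition as_cochains :: "nat \<Rightarrow> 'a topology \<Rightarrow> ('a list \<Rightarrow> 'r::ab_group_add) set" where
  "as_cochains p X = {\<phi>. \<forall>xs. \<phi> xs \<noteq> 0 \<longrightarrow> length xs = p + 1 \<and> set xs \<subseteq> topspace X}"

definition as_cochain_group :: "nat \<Rightarrow> 'a topology \<Rightarrow> ('a list \<Rightarrow> 'r::ab_group_add) monoid" where
  "as_cochain_group p X =
     \<lparr>carrier = as_cochains p X, mult = (\<lambda>\<phi> \<psi> xs. \<phi> xs + \<psi> xs), one = (\<lambda>_. 0)\<rparr>"

definition as_locally_zero :: "nat \<Rightarrow> 'a topology \<Rightarrow> ('a list \<Rightarrow> 'r::ab_group_add) set" where
  "as_locally_zero p X = {\<phi> \<in> as_cochains p X.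
     \<exists>\<U>. (\<forall>U\<in>\<U>. openin X U) \<and> \<Union>\<U> = topspace X \<and> (\<forall>U\<in>\<U>. \<forall>xs. set xs \<subseteq> U \<longrightarrow> \<phi> xs = 0)}"

text \<open>
  \<open>as_sign i y\<close> is \<open>(-1)^i * y\<close>; it is defined without a power of \<open>-1\<close> because the
  coefficients need not have a unit.
\<close>

definition as_sign :: "nat \<Rightarrow> 'r::ab_group_add \<Rightarrow> 'r" where
  "as_sign i y = (if even i then y else - y)"

definition as_face :: "nat \<Rightarrow> 'a list \<Rightarrow> 'a list" where
  "as_face i xs = take i xs @ drop (i + 1) xs"

definition as_delta :: "nat \<Rightarrow> 'a topology \<Rightarrow> ('a list \<Rightarrow> 'r::ab_group_add) \<Rightarrow> 'a list \<Rightarrow> 'r" where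
  "as_delta p X \<phi> = (\<lambda>xs. if length xs = p + 2 \<and> set xs \<subseteq> topspace X
     then \<Sum>i\<le>p + 1. as_sign i (\<phi> (as_face i xs)) else 0)"

definition as_cocycles :: "nat \<Rightarrow> 'a topology \<Rightarrow> ('a list \<Rightarrow> 'r::ab_group_add) set" where
  "as_cocycles p X = {\<phi> \<in> as_cochains p X. as_delta p X \<phi> \<in> as_locally_zero (p + 1) X}"

fun as_coboundaries :: "nat \<Rightarrow> 'a topology \<Rightarrow> ('a list \<Rightarrow> 'r::ab_group_add) set" where
  "as_coboundaries 0 X = as_locally_zero 0 X"
| "as_coboundaries (Suc p) X = {\<phi> \<in> as_cochains (Suc p) X.
     \<exists>\<psi> \<in> as_cochains p X. (\<lambda>xs. \<phi> xs - as_delta p X \<psi> xs) \<in> as_locally_zero (Suc p) X}"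

definition as_cohomology :: "nat \<Rightarrow> 'a topology \<Rightarrow> ('a list \<Rightarrow> 'r::ab_group_add) set monoid" where
  "as_cohomology p X =
     as_cochain_group p X \<lparr>carrier := as_cocycles p X\<rparr> Mod as_coboundaries p X"

definition as_class :: "nat \<Rightarrow> 'a topology \<Rightarrow> ('a list \<Rightarrow> 'r::ab_group_add) \<Rightarrow> ('a list \<Rightarrow> 'r) set" where
  "as_class p X \<phi> = as_coboundaries p X #>\<^bsub>as_cochain_group p X\<^esub> \<phi>"

definition as_pullback :: "'a topology \<Rightarrow> ('a \<Rightarrow> 'b) \<Rightarrow> ('b list \<Rightarrow> 'r::ab_group_add) \<Rightarrow> 'a list \<Rightarrow> 'r" where
  "as_pullback X f \<phi> = (\<lambda>xs. if set xs \<subseteq> topspace X then \<phi> (map f xs) else 0)"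

definition as_induced ::
  "nat \<Rightarrow> 'a topology \<Rightarrow> ('a \<Rightarrow> 'b) \<Rightarrow> ('b list \<Rightarrow> 'r::ab_group_add) set \<Rightarrow> ('a list \<Rightarrow> 'r) set" where
  "as_induced p X f a = (\<Union>\<phi>\<in>a. as_class p X (as_pullback X f \<phi>))"

definition as_cochain_cup ::
  "nat \<Rightarrow> nat \<Rightarrow> ('a list \<Rightarrow> 'r::ring) \<Rightarrow> ('a list \<Rightarrow> 'r) \<Rightarrow> 'a list \<Rightarrow> 'r" where
  "as_cochain_cup p q \<phi> \<psi> = (\<lambda>xs. if length xs = p + q + 1
     then \<phi> (take (p + 1) xs) * \<psi> (drop p xs) else 0)"

definition as_cup ::
  "nat \<Rightarrow> nat \<Rightarrow> 'a topology \<Rightarrow> ('a list \<Rightarrow> 'r::ring) set \<Rightarrow> ('a list \<Rightarrow> 'r) set \<Rightarrow> ('a list \<Rightarrow> 'r) set" where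
  "as_cup p q X a b = (\<Union>\<phi>\<in>a. \<Union>\<psi>\<in>b. as_class (p + q) X (as_cochain_cup p q \<phi> \<psi>))"


section \<open>The cohomology operations are well defined\<close>

lemma as_cochain_group_simps [simp]:
  "carrier (as_cochain_group p X) = as_cochains p X"
  "mult (as_cochain_group p X) \<phi> \<psi> = (\<lambda>xs. \<phi> xs + \<psi> xs)"
  "one (as_cochain_group p X) = (\<lambda>_. 0)"
  by (simp_all add: as_cochain_group_def)

lemma as_cochainsI:
  "(\<And>xs. \<phi> xs \<noteq> 0 \<Longrightarrow> length xs = p + 1 \<and> set xs \<subseteq> topspace X) \<Longrightarrow> \<phi> \<in> as_cochains p X"
  by (simp add: as_cochains_def)

lemma as_cochains_outside:
  "\<phi> \<in> as_cochains p X \<Longrightarrow> \<not> (length xs = p + 1 \<and> set xs \<subseteq> topspace X) \<Longrightarrow> \<phi> xs = 0"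
  unfolding as_cochains_def by blast

lemma as_cochainsI':
  "(\<And>xs. \<not> (length xs = p + 1 \<and> set xs \<subseteq> topspace X) \<Longrightarrow> \<phi> xs = 0) \<Longrightarrow> \<phi> \<in> as_cochains p X"
  unfolding as_cochains_def by blast

lemma as_cochains_zero [simp]: "(\<lambda>_. 0) \<in> as_cochains p X"
  by (rule as_cochainsI') (rule refl)

lemma as_cochains_add:
  assumes "\<phi> \<in> as_cochains p X" "\<psi> \<in> as_cochains p X"
  shows "(\<lambda>xs. \<phi> xs + \<psi> xs) \<in> as_cochains p X"
  using as_cochains_outside[OF assms(1)] as_cochains_outside[OF assms(2)]
  by (intro as_cochainsI') (metis add_0 diff_self)

lemma as_cochains_diff:
  assumes "\<phi> \<in> as_cochains p X" "\<psi> \<in> as_cochains p X"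
  shows "(\<lambda>xs. \<phi> xs - \<psi> xs) \<in> as_cochains p X"
  using as_cochains_outside[OF assms(1)] as_cochains_outside[OF assms(2)]
  by (intro as_cochainsI') (metis add_0 diff_self)

lemma as_cochains_uminus:
  assumes "\<phi> \<in> as_cochains p X"
  shows "(\<lambda>xs. - \<phi> xs) \<in> as_cochains p X"
  using as_cochains_outside[OF assms] by (intro as_cochainsI') (metis minus_zero)

lemma as_locally_zero_iff:
  "\<phi> \<in> as_locally_zero p X \<longleftrightarrow> \<phi> \<in> as_cochains p X \<and>
     (\<forall>x\<in>topspace X. \<exists>U. openin X U \<and> x \<in> U \<and> (\<forall>xs. set xs \<subseteq> U \<longrightarrow> \<phi> xs = 0))" (is "_ \<longleftrightarrow> _ \<and> ?R")
proof
  assume "\<phi> \<in> as_locally_zero p X"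
  then obtain \<U> where \<U>: "\<phi> \<in> as_cochains p X" "\<forall>U\<in>\<U>. openin X U" "\<Union>\<U> = topspace X"
    "\<forall>U\<in>\<U>. \<forall>xs. set xs \<subseteq> U \<longrightarrow> \<phi> xs = 0"
    unfolding as_locally_zero_def mem_Collect_eq by (elim conjE exE)
  have ?R
  proof
    fix x assume "x \<in> topspace X"
    then obtain U where "U \<in> \<U>" "x \<in> U" using \<U>(3) by (metis UnionE)
    with \<U>(2,4) show "\<exists>U. openin X U \<and> x \<in> U \<and> (\<forall>xs. set xs \<subseteq> U \<longrightarrow> \<phi> xs = 0)" by metis
  qed
  with \<U>(1) show "\<phi> \<in> as_cochains p X \<and> ?R" ..
next
  assume R: "\<phi> \<in> as_cochains p X \<and> ?R"
  let ?\<U> = "{U. openin X U \<and> (\<forall>xs. set xs \<subseteq> U \<longrightarrow> \<phi> xs = 0)}"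
  have "\<Union>?\<U> = topspace X"
  proof (intro equalityI subsetI)
    fix x assume "x \<in> \<Union>?\<U>"
    then obtain U where "openin X U" "x \<in> U" by (elim UnionE CollectE conjE)
    then show "x \<in> topspace X" by (metis openin_subset subsetD)
  next
    fix x assume "x \<in> topspace X"
    then obtain U where "U \<in> ?\<U>" "x \<in> U" using R unfolding mem_Collect_eq by metis
    then show "x \<in> \<Union>?\<U>" by (rule UnionI)
  qed
  then show "\<phi> \<in> as_locally_zero p X"
    unfolding as_locally_zero_def mem_Collect_eq
    by (intro conjI exI[of _ ?\<U>]) (use R in simp_all)
qed

lemma as_locally_zeroI:
  assumes "\<phi> \<in> as_cochains p X"
    and "\<And>x. x \<in> topspace X \<Longrightarrow> \<exists>U. openin X U \<and> x \<in> U \<and> (\<forall>xs. set xs \<subseteq> U \<longrightarrow> \<phi> xs = 0)"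
  shows "\<phi> \<in> as_locally_zero p X"
  unfolding as_locally_zero_iff using assms by (intro conjI ballI)

lemma as_locally_zeroE:
  assumes "\<phi> \<in> as_locally_zero p X" "x \<in> topspace X"
  obtains U where "openin X U" "x \<in> U" "\<And>xs. set xs \<subseteq> U \<Longrightarrow> \<phi> xs = 0"
  using assms unfolding as_locally_zero_iff by metis

lemma as_locally_zero_cochain: "\<phi> \<in> as_locally_zero p X \<Longrightarrow> \<phi> \<in> as_cochains p X"
  by (simp add: as_locally_zero_def)

lemma as_locally_zero_zero [simp]: "(\<lambda>_. 0) \<in> as_locally_zero p X"
  by (rule as_locally_zeroI[OF as_cochains_zero]) (metis openin_topspace)

lemma as_locally_zero_uminus:
  assumes "\<phi> \<in> as_locally_zero p X"
  shows "(\<lambda>xs. - \<phi> xs) \<in> as_locally_zero p X"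
proof (rule as_locally_zeroI)
  show "(\<lambda>xs. - \<phi> xs) \<in> as_cochains p X"
    using assms by (intro as_cochains_uminus as_locally_zero_cochain)
  fix x assume "x \<in> topspace X"
  with assms obtain U where "openin X U" "x \<in> U" "\<And>xs. set xs \<subseteq> U \<Longrightarrow> \<phi> xs = 0"
    by (rule as_locally_zeroE) (erule that)
  then show "\<exists>U. openin X U \<and> x \<in> U \<and> (\<forall>xs. set xs \<subseteq> U \<longrightarrow> - \<phi> xs = 0)"
    by (metis minus_zero)
qed

lemma as_locally_zero_add:
  assumes "\<phi> \<in> as_locally_zero p X" "\<psi> \<in> as_locally_zero p X"
  shows "(\<lambda>xs. \<phi> xs + \<psi> xs) \<in> as_locally_zero p X"
proof (rule as_locally_zeroI)
  show "(\<lambda>xs. \<phi> xs + \<psi> xs) \<in> as_cochains p X"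
    using assms by (intro as_cochains_add as_locally_zero_cochain)
  fix x assume x: "x \<in> topspace X"
  obtain U where U: "openin X U" "x \<in> U" "\<And>xs. set xs \<subseteq> U \<Longrightarrow> \<phi> xs = 0"
    using as_locally_zeroE[OF assms(1) x] by metis
  obtain V where V: "openin X V" "x \<in> V" "\<And>xs. set xs \<subseteq> V \<Longrightarrow> \<psi> xs = 0"
    using as_locally_zeroE[OF assms(2) x] by metis
  show "\<exists>U. openin X U \<and> x \<in> U \<and> (\<forall>xs. set xs \<subseteq> U \<longrightarrow> \<phi> xs + \<psi> xs = 0)"
    by (intro exI[of _ "U \<inter> V"] conjI allI impI openin_Int IntI) (simp_all add: U V)
qed

lemma as_locally_zero_diff:
  assumes "\<phi> \<in> as_locally_zero p X" "\<psi> \<in> as_locally_zero p X"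
  shows "(\<lambda>xs. \<phi> xs - \<psi> xs) \<in> as_locally_zero p X"
  using as_locally_zero_add[OF assms(1) as_locally_zero_uminus[OF assms(2)]] by simp

lemma set_as_face_subset: "set (as_face i xs) \<subseteq> set xs"
  by (auto simp: as_face_def dest: in_set_takeD in_set_dropD)

lemma length_as_face: "i < length xs \<Longrightarrow> length (as_face i xs) = length xs - 1"
  by (simp add: as_face_def)

lemma map_as_face: "map f (as_face i xs) = as_face i (map f xs)"
  by (simp add: as_face_def take_map drop_map)

lemma nth_as_face:
  "i < length xs \<Longrightarrow> k < length xs - 1 \<Longrightarrow> as_face i xs ! k = xs ! (if k < i then k else Suc k)"
  by (auto simp: as_face_def nth_append min_def)

lemma as_face_as_face:
  assumes "i < j" "j < length xs"
  shows "as_face i (as_face j xs) = as_face (j - 1) (as_face i xs)"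
proof (rule nth_equalityI)
  show "length (as_face i (as_face j xs)) = length (as_face (j - 1) (as_face i xs))"
    using assms by (simp add: length_as_face)
  fix k assume "k < length (as_face i (as_face j xs))"
  with assms have "k < length xs - 2" by (simp add: length_as_face)
  with assms show "as_face i (as_face j xs) ! k = as_face (j - 1) (as_face i xs) ! k"
    by (simp add: nth_as_face length_as_face) linarith
qed

lemma as_sign_simps [simp]: "as_sign i 0 = 0" "as_sign i (- y) = - as_sign i y"
  by (simp_all add: as_sign_def)

lemma as_sign_add: "as_sign i (x + y) = as_sign i x + as_sign i y"
  by (simp add: as_sign_def)

lemma as_sign_as_sign: "as_sign i (as_sign j y) = as_sign (i + j) y"
  by (simp add: as_sign_def)

lemma as_sign_Suc [simp]: "as_sign (Suc i) y = - as_sign i y"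
  by (simp add: as_sign_def)

lemma as_sign_sum: "as_sign i (sum f A) = (\<Sum>x\<in>A. as_sign i (f x))"
  by (simp add: as_sign_def sum_negf)

lemma as_sign_mult:
  fixes a b :: "'r::ring"
  shows "as_sign i (a * b) = as_sign i a * b" "as_sign i (a * b) = a * as_sign i b"
  by (simp_all add: as_sign_def)

lemma as_delta_apply:
  assumes "length xs = p + 2" "set xs \<subseteq> topspace X"
  shows "as_delta p X \<phi> xs = (\<Sum>i\<in>{..p+1}. as_sign i (\<phi> (as_face i xs)))"
  unfolding as_delta_def using assms by (simp only: simp_thms if_True)

lemma as_delta_outside:
  "\<not> (length xs = p + 2 \<and> set xs \<subseteq> topspace X) \<Longrightarrow> as_delta p X \<phi> xs = 0"
  by (auto simp: as_delta_def)

lemma as_delta_cochain: "as_delta p X \<phi> \<in> as_cochains (p + 1) X"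
  by (rule as_cochainsI) (auto simp: as_delta_def split: if_splits)

lemma as_delta_zero: "as_delta p X (\<lambda>_. 0) = (\<lambda>_. 0)"
  by (rule ext) (auto simp: as_delta_def)

lemma as_delta_add: "as_delta p X (\<lambda>xs. \<phi> xs + \<psi> xs) = (\<lambda>xs. as_delta p X \<phi> xs + as_delta p X \<psi> xs)"
  by (rule ext) (simp add: as_delta_def as_sign_add sum.distrib del: sum.atMost_Suc)

lemma as_delta_uminus: "as_delta p X (\<lambda>xs. - \<phi> xs) = (\<lambda>xs. - as_delta p X \<phi> xs)"
  by (rule ext) (simp add: as_delta_def sum_negf del: sum.atMost_Suc)

lemma as_delta_diff: "as_delta p X (\<lambda>xs. \<phi> xs - \<psi> xs) = (\<lambda>xs. as_delta p X \<phi> xs - as_delta p X \<psi> xs)"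
  using as_delta_add[of p X \<phi> "\<lambda>xs. - \<psi> xs"] by (simp add: as_delta_uminus)

lemma as_delta_locally_zero:
  assumes "\<phi> \<in> as_locally_zero p X"
  shows "as_delta p X \<phi> \<in> as_locally_zero (p + 1) X"
proof (rule as_locally_zeroI[OF as_delta_cochain])
  fix x assume "x \<in> topspace X"
  with assms obtain U where U: "openin X U" "x \<in> U" "\<And>xs. set xs \<subseteq> U \<Longrightarrow> \<phi> xs = 0"
    by (rule as_locally_zeroE) (erule that)
  have "as_delta p X \<phi> xs = 0" if xs: "set xs \<subseteq> U" for xs
  proof -
    have "\<phi> (as_face i xs) = 0" for i
      by (rule U(3)) (rule order_trans[OF set_as_face_subset xs])
    then show ?thesis unfolding as_delta_def by (simp del: sum.atMost_Suc)
  qed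
  with U(1,2) show "\<exists>U. openin X U \<and> x \<in> U \<and> (\<forall>xs. set xs \<subseteq> U \<longrightarrow> as_delta p X \<phi> xs = 0)" by metis
qed

lemma as_delta_delta: "as_delta (p + 1) X (as_delta p X \<phi>) = (\<lambda>_. 0)"
proof
  fix xs :: "'a list"
  show "as_delta (p + 1) X (as_delta p X \<phi>) xs = 0"
  proof (cases "length xs = p + 1 + 2 \<and> set xs \<subseteq> topspace X")
    case True
    have len: "length (as_face j xs) = p + 2" "set (as_face j xs) \<subseteq> topspace X" if "j \<le> p + 2" for j
      using True that set_as_face_subset[of j xs] by (auto simp: length_as_face)
    define F where "F j i = as_sign (j + i) (\<phi> (as_face i (as_face j xs)))" for j i
    define L where "L = {(j, i). j \<le> p + 2 \<and> i < j}"
    define G where "G = {(j, i). i \<le> p + 1 \<and> j \<le> i}"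
    have fin: "finite L" "finite G"
      by (rule finite_subset[of _ "{..p+2} \<times> {..p+2}"]; auto simp: L_def G_def)+
    have "as_delta (p + 1) X (as_delta p X \<phi>) xs = (\<Sum>j\<in>{..p+1+1}. as_sign j (as_delta p X \<phi> (as_face j xs)))"
      using True by (intro as_delta_apply) auto
    also have "\<dots> = (\<Sum>j\<in>{..p+1+1}. \<Sum>i\<in>{..p+1}. F j i)"
    proof (rule sum.cong[OF refl])
      fix j assume "j \<in> {..p+1+1}"
      then have "as_delta p X \<phi> (as_face j xs) = (\<Sum>i\<in>{..p+1}. as_sign i (\<phi> (as_face i (as_face j xs))))"
        by (intro as_delta_apply len) auto
      then show "as_sign j (as_delta p X \<phi> (as_face j xs)) = (\<Sum>i\<in>{..p+1}. F j i)"
        by (simp only: as_sign_sum as_sign_as_sign F_def)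
    qed
    also have "\<dots> = sum (\<lambda>(j, i). F j i) ({..p+1+1} \<times> {..p+1})"
      by (rule sum.cartesian_product)
    also have "{..p+1+1} \<times> {..p+1} = L \<union> G"
      by (auto simp: L_def G_def)
    also have "sum (\<lambda>(j, i). F j i) (L \<union> G) = sum (\<lambda>(j, i). F j i) L + sum (\<lambda>(j, i). F j i) G"
      by (rule sum.union_disjoint) (use fin in \<open>auto simp: L_def G_def\<close>)
    also have "sum (\<lambda>(j, i). F j i) L = sum (\<lambda>(j, i). - F j i) G"
    proof (rule sum.reindex_bij_witness[of _ "\<lambda>(j, i). (i + 1, j)" "\<lambda>(j, i). (i, j - 1)"])
      fix a assume "a \<in> L"
      then obtain i k where a: "a = (Suc k, i)" "k \<le> p + 1" "i \<le> k"
        by (auto simp: L_def gr0_conv_Suc elim: less_natE)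
      then have "as_face i (as_face (Suc k) xs) = as_face k (as_face i xs)"
        using as_face_as_face[of i "Suc k" xs] True by simp
      then have "F (Suc k) i = - F i k"
        by (simp add: F_def add.commute)
      then show "(case case a of (j, i) \<Rightarrow> (i, j - 1) of (j, i) \<Rightarrow> - F j i) = (case a of (j, i) \<Rightarrow> F j i)"
        using a by simp
    qed (auto simp: L_def G_def)
    finally show ?thesis by (simp add: sum_negf case_prod_beta)
  qed (rule as_delta_outside)
qed

lemma as_cocycles_add: "\<phi> \<in> as_cocycles p X \<Longrightarrow> \<psi> \<in> as_cocycles p X \<Longrightarrow> (\<lambda>xs. \<phi> xs + \<psi> xs) \<in> as_cocycles p X"
  by (simp add: as_cocycles_def as_cochains_add as_delta_add as_locally_zero_add)

lemma as_cocycles_uminus: "\<phi> \<in> as_cocycles p X \<Longrightarrow> (\<lambda>xs. - \<phi> xs) \<in> as_cocycles p X"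
  by (simp add: as_cocycles_def as_cochains_uminus as_delta_uminus as_locally_zero_uminus)

lemma as_cocycles_zero [simp]: "(\<lambda>_. 0) \<in> as_cocycles p X"
  by (simp add: as_cocycles_def as_delta_zero)

lemma as_locally_zero_subset_coboundaries: "as_locally_zero p X \<subseteq> as_coboundaries p X"
proof (cases p)
  case (Suc q)
  then show ?thesis
    by (auto simp: as_locally_zero_cochain as_delta_zero intro!: bexI[of _ "\<lambda>_. 0"])
qed simp

lemma as_coboundaries_add:
  "\<phi> \<in> as_coboundaries p X \<Longrightarrow> \<psi> \<in> as_coboundaries p X \<Longrightarrow> (\<lambda>xs. \<phi> xs + \<psi> xs) \<in> as_coboundaries p X"
proof (cases p)
  case (Suc q)
  assume "\<phi> \<in> as_coboundaries p X" "\<psi> \<in> as_coboundaries p X"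
  with Suc obtain \<phi>' \<psi>' where *: "\<phi> \<in> as_cochains p X" "\<psi> \<in> as_cochains p X"
    "\<phi>' \<in> as_cochains q X" "\<psi>' \<in> as_cochains q X"
    "(\<lambda>xs. \<phi> xs - as_delta q X \<phi>' xs) \<in> as_locally_zero p X"
    "(\<lambda>xs. \<psi> xs - as_delta q X \<psi>' xs) \<in> as_locally_zero p X" by auto
  have "(\<lambda>xs. (\<phi> xs + \<psi> xs) - as_delta q X (\<lambda>xs. \<phi>' xs + \<psi>' xs) xs) \<in> as_locally_zero p X"
    using as_locally_zero_add[OF *(5,6)] by (simp add: as_delta_add algebra_simps)
  with * Suc show ?thesis by (auto intro!: as_cochains_add bexI[of _ "\<lambda>xs. \<phi>' xs + \<psi>' xs"])
qed (simp add: as_locally_zero_add)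

lemma as_coboundaries_uminus:
  "\<phi> \<in> as_coboundaries p X \<Longrightarrow> (\<lambda>xs. - \<phi> xs) \<in> as_coboundaries p X"
proof (cases p)
  case (Suc q)
  assume "\<phi> \<in> as_coboundaries p X"
  with Suc obtain \<phi>' where *: "\<phi> \<in> as_cochains p X" "\<phi>' \<in> as_cochains q X"
    "(\<lambda>xs. \<phi> xs - as_delta q X \<phi>' xs) \<in> as_locally_zero p X" by auto
  have "(\<lambda>xs. - \<phi> xs - as_delta q X (\<lambda>xs. - \<phi>' xs) xs) \<in> as_locally_zero p X"
    using as_locally_zero_uminus[OF *(3)] by (simp add: as_delta_uminus algebra_simps)
  with * Suc show ?thesis by (auto intro!: as_cochains_uminus bexI[of _ "\<lambda>xs. - \<phi>' xs"])
qed (simp add: as_locally_zero_uminus)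

lemma as_coboundaries_subset_cocycles: "as_coboundaries p X \<subseteq> as_cocycles p X"
proof (cases p)
  case 0
  then show ?thesis
    using as_delta_locally_zero[of _ 0 X] by (auto simp: as_cocycles_def as_locally_zero_cochain)
next
  case (Suc q)
  show ?thesis
  proof
    fix \<phi> :: "'a list \<Rightarrow> 'b" assume "\<phi> \<in> as_coboundaries p X"
    with Suc obtain \<psi> where *: "\<phi> \<in> as_cochains p X"
      "(\<lambda>xs. \<phi> xs - as_delta q X \<psi> xs) \<in> as_locally_zero p X" by auto
    have "as_delta p X (\<lambda>xs. \<phi> xs - as_delta q X \<psi> xs) = as_delta p X \<phi>"
      using as_delta_delta[of q X \<psi>] Suc by (simp add: as_delta_diff)
    with as_delta_locally_zero[OF *(2)] * show "\<phi> \<in> as_cocycles p X"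
      by (simp add: as_cocycles_def)
  qed
qed

lemma comm_group_as_cocycles: "comm_group (as_cochain_group p X\<lparr>carrier := as_cocycles p X\<rparr>)"
  by (rule comm_groupI)
    (auto simp: as_cocycles_add algebra_simps intro!: bexI[OF _ as_cocycles_uminus])

lemma normal_as_coboundaries:
  "as_coboundaries p X \<lhd> as_cochain_group p X\<lparr>carrier := as_cocycles p X\<rparr>"
proof -
  interpret G: comm_group "as_cochain_group p X\<lparr>carrier := as_cocycles p X\<rparr>"
    by (rule comm_group_as_cocycles)
  have inv: "inv\<^bsub>as_cochain_group p X\<lparr>carrier := as_cocycles p X\<rparr>\<^esub> \<phi> = (\<lambda>xs. - \<phi> xs)"
    if "\<phi> \<in> as_cocycles p X" for \<phi>
    by (rule G.inv_equality) (use that in \<open>auto simp: as_cocycles_uminus\<close>)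
  have "subgroup (as_coboundaries p X) (as_cochain_group p X\<lparr>carrier := as_cocycles p X\<rparr>)"
    using as_coboundaries_subset_cocycles[of p X] as_locally_zero_subset_coboundaries[of p X]
    by (intro G.subgroupI) (auto simp: inv subset_iff as_coboundaries_uminus as_coboundaries_add
        intro: as_locally_zero_zero)
  then show ?thesis by (simp add: G.normal_iff_subgroup)
qed

lemma group_as_cohomology: "group (as_cohomology p X)"
  unfolding as_cohomology_def by (rule normal.factorgroup_is_group[OF normal_as_coboundaries])

lemma one_as_cohomology [simp]: "\<one>\<^bsub>as_cohomology p X\<^esub> = as_coboundaries p X"
  by (simp add: as_cohomology_def)

lemma carrier_as_cohomology: "carrier (as_cohomology p X) = as_class p X ` as_cocycles p X"
  by (auto simp: as_cohomology_def as_class_def carrier_FactGroup r_coset_def)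

lemma as_class_iff: "\<psi> \<in> as_class p X \<phi> \<longleftrightarrow> (\<lambda>xs. \<psi> xs - \<phi> xs) \<in> as_coboundaries p X"
proof
  assume "(\<lambda>xs. \<psi> xs - \<phi> xs) \<in> as_coboundaries p X"
  then show "\<psi> \<in> as_class p X \<phi>"
    unfolding as_class_def r_coset_def by (auto intro!: bexI[of _ "\<lambda>xs. \<psi> xs - \<phi> xs"])
qed (auto simp: as_class_def r_coset_def)

lemma as_class_eq_iff:
  "as_class p X \<phi> = as_class p X \<psi> \<longleftrightarrow> (\<lambda>xs. \<phi> xs - \<psi> xs) \<in> as_coboundaries p X"
proof
  assume "as_class p X \<phi> = as_class p X \<psi>"
  moreover have "\<phi> \<in> as_class p X \<phi>"
    using as_locally_zero_subset_coboundaries[of p X] by (auto simp: as_class_iff)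
  ultimately show "(\<lambda>xs. \<phi> xs - \<psi> xs) \<in> as_coboundaries p X" by (simp add: as_class_iff)
next
  assume *: "(\<lambda>xs. \<phi> xs - \<psi> xs) \<in> as_coboundaries p X"
  show "as_class p X \<phi> = as_class p X \<psi>"
    unfolding set_eq_iff as_class_iff
  proof (intro allI iffI)
    fix \<theta> assume "(\<lambda>xs. \<theta> xs - \<phi> xs) \<in> as_coboundaries p X"
    from as_coboundaries_add[OF this *] show "(\<lambda>xs. \<theta> xs - \<psi> xs) \<in> as_coboundaries p X" by simp
  next
    fix \<theta> assume "(\<lambda>xs. \<theta> xs - \<psi> xs) \<in> as_coboundaries p X"
    from as_coboundaries_add[OF this as_coboundaries_uminus[OF *]]
    show "(\<lambda>xs. \<theta> xs - \<phi> xs) \<in> as_coboundaries p X" by simp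
  qed
qed

lemma as_pullback_cochain:
  assumes "\<phi> \<in> as_cochains p Y"
  shows "as_pullback X f \<phi> \<in> as_cochains p X"
proof (rule as_cochainsI)
  fix xs assume *: "as_pullback X f \<phi> xs \<noteq> 0"
  then have "\<phi> (map f xs) \<noteq> 0" "set xs \<subseteq> topspace X"
    unfolding as_pullback_def by (meson, meson)
  with as_cochains_outside[OF assms, of "map f xs"] show "length xs = p + 1 \<and> set xs \<subseteq> topspace X"
    by auto
qed

lemma as_pullback_diff:
  "as_pullback X f (\<lambda>xs. \<phi> xs - \<psi> xs) = (\<lambda>xs. as_pullback X f \<phi> xs - as_pullback X f \<psi> xs)"
  by (rule ext) (simp add: as_pullback_def)

lemma as_pullback_delta:
  fixes f :: "'a \<Rightarrow> 'b"
  assumes "f ` topspace X \<subseteq> topspace Y"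
  shows "as_pullback X f (as_delta p Y \<phi>) = as_delta p X (as_pullback X f \<phi>)"
proof
  fix xs :: "'a list"
  show "as_pullback X f (as_delta p Y \<phi>) xs = as_delta p X (as_pullback X f \<phi>) xs"
  proof (cases "length xs = p + 2 \<and> set xs \<subseteq> topspace X")
    case True
    have "set (as_face i xs) \<subseteq> topspace X" for i
      using True set_as_face_subset[of i xs] by blast
    moreover have "set (map f xs) \<subseteq> topspace Y" using True assms by auto
    ultimately show ?thesis
      using True by (simp add: as_pullback_def as_delta_apply map_as_face del: sum.atMost_Suc)
  qed (auto simp: as_pullback_def as_delta_def)
qed

lemma as_pullback_locally_zero:
  assumes f: "continuous_map X Y f" and \<phi>: "\<phi> \<in> as_locally_zero p Y"
  shows "as_pullback X f \<phi> \<in> as_locally_zero p X"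
proof (rule as_locally_zeroI)
  show "as_pullback X f \<phi> \<in> as_cochains p X"
    using \<phi> by (intro as_pullback_cochain as_locally_zero_cochain)
  fix x assume x: "x \<in> topspace X"
  then have "f x \<in> topspace Y" using f by (auto simp: continuous_map_def)
  with \<phi> obtain U where U: "openin Y U" "f x \<in> U" "\<And>xs. set xs \<subseteq> U \<Longrightarrow> \<phi> xs = 0"
    by (rule as_locally_zeroE) (erule that)
  let ?V = "{x \<in> topspace X. f x \<in> U}"
  have "openin X ?V" using f U(1) by (rule openin_continuous_map_preimage)
  moreover have "x \<in> ?V" using x U(2) by simp
  moreover have "as_pullback X f \<phi> xs = 0" if "set xs \<subseteq> ?V" for xs
  proof -
    have "set (map f xs) \<subseteq> U" using that by auto
    from U(3)[OF this] show ?thesis by (simp add: as_pullback_def)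
  qed
  ultimately show "\<exists>U. openin X U \<and> x \<in> U \<and> (\<forall>xs. set xs \<subseteq> U \<longrightarrow> as_pullback X f \<phi> xs = 0)"
    by metis
qed

lemma as_pullback_cocycle:
  assumes f: "continuous_map X Y f" and \<phi>: "\<phi> \<in> as_cocycles p Y"
  shows "as_pullback X f \<phi> \<in> as_cocycles p X"
proof -
  have "\<phi> \<in> as_cochains p Y" "as_delta p Y \<phi> \<in> as_locally_zero (p + 1) Y"
    using \<phi> by (simp_all add: as_cocycles_def)
  from as_pullback_cochain[OF this(1)] as_pullback_locally_zero[OF f this(2)]
  show ?thesis
    unfolding as_pullback_delta[OF continuous_map_image_subset_topspace[OF f]]
    by (simp add: as_cocycles_def)
qed

lemma as_pullback_coboundary:
  assumes f: "continuous_map X Y f" and \<phi>: "\<phi> \<in> as_coboundaries p Y"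
  shows "as_pullback X f \<phi> \<in> as_coboundaries p X"
proof (cases p)
  case 0
  with assms show ?thesis by (simp add: as_pullback_locally_zero)
next
  case (Suc q)
  with \<phi> obtain \<psi> where *: "\<phi> \<in> as_cochains p Y" "\<psi> \<in> as_cochains q Y"
    "(\<lambda>xs. \<phi> xs - as_delta q Y \<psi> xs) \<in> as_locally_zero p Y" by auto
  have "(\<lambda>xs. as_pullback X f \<phi> xs - as_delta q X (as_pullback X f \<psi>) xs) \<in> as_locally_zero p X"
    using as_pullback_locally_zero[OF f *(3)]
    by (simp add: as_pullback_diff as_pullback_delta[OF continuous_map_image_subset_topspace[OF f]])
  then show ?thesis
    using as_pullback_cochain[OF *(1), of X f] as_pullback_cochain[OF *(2), of X f] Suc by auto
qed

lemma as_class_self: "\<phi> \<in> as_class p X \<phi>"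
  using as_class_eq_iff[of p X \<phi> \<phi>] as_class_iff[of \<phi> p X \<phi>] by simp

lemma as_induced_class:
  assumes "continuous_map X Y f"
  shows "as_induced p X f (as_class p Y \<phi>) = as_class p X (as_pullback X f \<phi>)"
proof -
  have "as_class p X (as_pullback X f \<psi>) = as_class p X (as_pullback X f \<phi>)"
    if "\<psi> \<in> as_class p Y \<phi>" for \<psi>
    using that as_pullback_coboundary[OF assms, of "\<lambda>xs. \<psi> xs - \<phi> xs" p]
    by (simp add: as_class_iff as_class_eq_iff as_pullback_diff)
  then show ?thesis
    unfolding as_induced_def using as_class_self[of \<phi> p Y] by blast
qed

lemma as_cochain_cup_cochain:
  assumes "\<phi> \<in> as_cochains p X" "\<psi> \<in> as_cochains q X"
  shows "as_cochain_cup p q \<phi> \<psi> \<in> as_cochains (p + q) X"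
proof (rule as_cochainsI)
  fix xs assume "as_cochain_cup p q \<phi> \<psi> xs \<noteq> 0"
  then have len: "length xs = p + q + 1" and "\<phi> (take (p + 1) xs) \<noteq> 0" "\<psi> (drop p xs) \<noteq> 0"
    by (auto simp: as_cochain_cup_def split: if_splits)
  then have "set (take (p + 1) xs) \<subseteq> topspace X" "set (drop p xs) \<subseteq> topspace X"
    using as_cochains_outside[OF assms(1)] as_cochains_outside[OF assms(2)] by blast+
  moreover have "set xs = set (take p xs) \<union> set (drop p xs)"
    by (metis append_take_drop_id set_append)
  moreover have "set (take p xs) \<subseteq> set (take (p + 1) xs)"
    by (rule set_take_subset_set_take) simp
  ultimately show "length xs = p + q + 1 \<and> set xs \<subseteq> topspace X" using len by blast
qed

lemma as_cochain_cup_locally_zero: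
  assumes "\<phi> \<in> as_cochains p X" "\<psi> \<in> as_cochains q X"
    and "\<phi> \<in> as_locally_zero p X \<or> \<psi> \<in> as_locally_zero q X"
  shows "as_cochain_cup p q \<phi> \<psi> \<in> as_locally_zero (p + q) X"
proof (rule as_locally_zeroI)
  show "as_cochain_cup p q \<phi> \<psi> \<in> as_cochains (p + q) X"
    using assms(1,2) by (rule as_cochain_cup_cochain)
  fix x assume x: "x \<in> topspace X"
  obtain U where U: "openin X U" "x \<in> U"
    "(\<forall>xs. set xs \<subseteq> U \<longrightarrow> \<phi> xs = 0) \<or> (\<forall>xs. set xs \<subseteq> U \<longrightarrow> \<psi> xs = 0)"
    using assms(3) as_locally_zeroE[OF _ x] by metis
  have "as_cochain_cup p q \<phi> \<psi> xs = 0" if xs: "set xs \<subseteq> U" for xs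
  proof -
    have "set (take (p + 1) xs) \<subseteq> U" "set (drop p xs) \<subseteq> U"
      by (rule order_trans[OF set_take_subset xs], rule order_trans[OF set_drop_subset xs])
    with U(3) have "\<phi> (take (p + 1) xs) = 0 \<or> \<psi> (drop p xs) = 0" by metis
    then show ?thesis unfolding as_cochain_cup_def by (elim disjE) simp_all
  qed
  with U show "\<exists>U. openin X U \<and> x \<in> U \<and> (\<forall>xs. set xs \<subseteq> U \<longrightarrow> as_cochain_cup p q \<phi> \<psi> xs = 0)"
    by metis
qed

lemma as_delta_cochain_cup:
  fixes \<phi> \<psi> :: "'a list \<Rightarrow> 'r::ring"
  assumes \<phi>: "\<phi> \<in> as_cochains p X" and \<psi>: "\<psi> \<in> as_cochains q X"
  shows "as_delta (p + q) X (as_cochain_cup p q \<phi> \<psi>) =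
    (\<lambda>xs. as_cochain_cup (p + 1) q (as_delta p X \<phi>) \<psi> xs +
      as_sign p (as_cochain_cup p (q + 1) \<phi> (as_delta q X \<psi>) xs))"
proof
  fix xs :: "'a list"
  show "as_delta (p + q) X (as_cochain_cup p q \<phi> \<psi>) xs =
     as_cochain_cup (p + 1) q (as_delta p X \<phi>) \<psi> xs +
      as_sign p (as_cochain_cup p (q + 1) \<phi> (as_delta q X \<psi>) xs)" (is "?L = ?A + ?B")
  proof (cases "length xs = p + q + 2 \<and> set xs \<subseteq> topspace X")
    case False
    have A: "as_cochain_cup (p + 1) q (as_delta p X \<phi>) \<psi> \<in> as_cochains (p + 1 + q) X"
      by (intro as_cochain_cup_cochain as_delta_cochain \<psi>)
    have B: "as_cochain_cup p (q + 1) \<phi> (as_delta q X \<psi>) \<in> as_cochains (p + (q + 1)) X"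
      by (intro as_cochain_cup_cochain as_delta_cochain \<phi>)
    have "as_cochain_cup (p + 1) q (as_delta p X \<phi>) \<psi> xs = 0"
      using False by (intro as_cochains_outside[OF A]) auto
    moreover have "as_cochain_cup p (q + 1) \<phi> (as_delta q X \<psi>) xs = 0"
      using False by (intro as_cochains_outside[OF B]) auto
    ultimately show ?thesis using as_delta_outside[OF False] by simp
  next
    case True
    then have len: "length xs = p + q + 2" and sub: "set xs \<subseteq> topspace X" by auto
    have sub': "set (take k xs) \<subseteq> topspace X" "set (drop k xs) \<subseteq> topspace X" for k
      by (rule order_trans[OF set_take_subset sub], rule order_trans[OF set_drop_subset sub])
    let ?P = "take (p + 1) xs" and ?Q = "drop (p + 1) xs"
    let ?f = "\<lambda>i. as_sign i (\<phi> (take (p + 1) (as_face i xs)) * \<psi> (drop p (as_face i xs)))"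
    let ?S = "\<Sum>i\<in>{..p}. as_sign i (\<phi> (as_face i (take (p + 2) xs)) * \<psi> ?Q)"
    let ?T = "\<Sum>j\<in>{..q}. as_sign (p + Suc j) (\<phi> ?P * \<psi> (as_face (Suc j) (drop p xs)))"
    have "?L = (\<Sum>i\<in>{..p+q+1}. as_sign i (as_cochain_cup p q \<phi> \<psi> (as_face i xs)))"
      using len sub by (rule as_delta_apply)
    also have "\<dots> = sum ?f {..p+q+1}"
      using len by (intro sum.cong) (auto simp: as_cochain_cup_def length_as_face)
    also have "{..p+q+1} = {..p} \<union> {p+1..p+1+q}" by auto
    also have "sum ?f ({..p} \<union> {p+1..p+1+q}) = sum ?f {..p} + sum ?f {p+1..p+1+q}"
      by (rule sum.union_disjoint) auto
    also have "sum ?f {..p} = ?S"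
    proof (rule sum.cong[OF refl])
      fix i assume "i \<in> {..p}"
      then have "take (p + 1) (as_face i xs) = as_face i (take (p + 2) xs)" "drop p (as_face i xs) = ?Q"
        using len by (auto simp: as_face_def take_drop min_def Suc_diff_le)
      then show "?f i = as_sign i (\<phi> (as_face i (take (p + 2) xs)) * \<psi> ?Q)" by simp
    qed
    also have "sum ?f {p+1..p+1+q} = ?T"
    proof (rule sum.reindex_bij_witness[of _ "\<lambda>j. p + 1 + j" "\<lambda>i. i - (p + 1)"])
      fix i assume "i \<in> {p+1..p+1+q}"
      then obtain j where i: "i = p + 1 + j" and j: "j \<le> q"
        by (metis atLeastAtMost_iff le_Suc_ex nat_add_left_cancel_le)
      have "take (p + 1) (as_face i xs) = ?P" "drop p (as_face i xs) = as_face (Suc j) (drop p xs)"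
        using i j len by (auto simp: as_face_def drop_take min_def add.commute)
      then show "as_sign (p + Suc (i - (p + 1))) (\<phi> ?P * \<psi> (as_face (Suc (i - (p + 1))) (drop p xs))) = ?f i"
        using i by simp
    qed auto
    finally have L: "?L = ?S + ?T" .
    have A: "?A = ?S + as_sign (p + 1) (\<phi> ?P * \<psi> ?Q)"
    proof -
      have "?A = as_delta p X \<phi> (take (p + 2) xs) * \<psi> ?Q"
        using len by (simp add: as_cochain_cup_def)
      also have "as_delta p X \<phi> (take (p + 2) xs) = (\<Sum>i\<in>{..p+1}. as_sign i (\<phi> (as_face i (take (p + 2) xs))))"
        by (rule as_delta_apply) (use len sub' in auto)
      also have "\<dots> * \<psi> ?Q = (\<Sum>i\<in>{..p+1}. as_sign i (\<phi> (as_face i (take (p + 2) xs)) * \<psi> ?Q))"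
        by (simp only: sum_distrib_right as_sign_mult(1))
      also have "\<dots> = ?S + as_sign (p + 1) (\<phi> (as_face (p + 1) (take (p + 2) xs)) * \<psi> ?Q)"
        by simp
      also have "as_face (p + 1) (take (p + 2) xs) = ?P"
        using len by (simp add: as_face_def min_def)
      finally show ?thesis .
    qed
    have B: "?B = as_sign p (\<phi> ?P * \<psi> ?Q) + ?T"
    proof -
      have "?B = as_sign p (\<phi> ?P * as_delta q X \<psi> (drop p xs))"
        using len by (simp add: as_cochain_cup_def)
      also have "as_delta q X \<psi> (drop p xs) = (\<Sum>j\<in>{..q+1}. as_sign j (\<psi> (as_face j (drop p xs))))"
        by (rule as_delta_apply) (use len sub' in auto)
      also have "as_sign p (\<phi> ?P * \<dots>) = (\<Sum>j\<in>{..q+1}. as_sign (p + j) (\<phi> ?P * \<psi> (as_face j (drop p xs))))"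
        by (simp only: sum_distrib_left as_sign_sum as_sign_mult(2)[symmetric] as_sign_as_sign)
      also have "\<dots> = (\<Sum>j\<le>Suc q. as_sign (p + j) (\<phi> ?P * \<psi> (as_face j (drop p xs))))" by simp
      also have "\<dots> = as_sign (p + 0) (\<phi> ?P * \<psi> (as_face 0 (drop p xs))) + ?T"
        by (rule sum.atMost_Suc_shift)
      also have "as_face 0 (drop p xs) = ?Q" by (simp add: as_face_def)
      finally show ?thesis by simp
    qed
    have zero: "as_sign (p + 1) (\<phi> ?P * \<psi> ?Q) + as_sign p (\<phi> ?P * \<psi> ?Q) = 0" by simp
    have alg: "s + a + (b + t) = s + t" if "a + b = 0" for s a b t :: 'r
    proof -
      have "s + a + (b + t) = s + (a + b) + t" by (simp only: add.assoc)
      with that show ?thesis by simp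
    qed
    from alg[OF zero] have "?S + as_sign (p + 1) (\<phi> ?P * \<psi> ?Q) + (as_sign p (\<phi> ?P * \<psi> ?Q) + ?T) = ?S + ?T"
      .
    then show ?thesis unfolding L A B by (rule sym)
  qed
qed

lemma as_sign_locally_zero: "\<phi> \<in> as_locally_zero p X \<Longrightarrow> (\<lambda>xs. as_sign i (\<phi> xs)) \<in> as_locally_zero p X"
  by (cases "even i") (simp_all add: as_sign_def as_locally_zero_uminus)

lemma as_cochain_cup_cocycle:
  assumes "\<phi> \<in> as_cocycles p X" "\<psi> \<in> as_cocycles q X"
  shows "as_cochain_cup p q \<phi> \<psi> \<in> as_cocycles (p + q) X"
proof -
  have c: "\<phi> \<in> as_cochains p X" "\<psi> \<in> as_cochains q X"
    "as_delta p X \<phi> \<in> as_locally_zero (p + 1) X" "as_delta q X \<psi> \<in> as_locally_zero (q + 1) X"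
    using assms by (auto simp: as_cocycles_def)
  have "as_cochain_cup (p + 1) q (as_delta p X \<phi>) \<psi> \<in> as_locally_zero (p + 1 + q) X"
    using c by (intro as_cochain_cup_locally_zero) (auto simp: as_locally_zero_cochain)
  moreover have "as_cochain_cup p (q + 1) \<phi> (as_delta q X \<psi>) \<in> as_locally_zero (p + (q + 1)) X"
    using c by (intro as_cochain_cup_locally_zero) (auto simp: as_locally_zero_cochain)
  ultimately have "as_delta (p + q) X (as_cochain_cup p q \<phi> \<psi>) \<in> as_locally_zero (p + q + 1) X"
    unfolding as_delta_cochain_cup[OF c(1,2)]
    by (intro as_locally_zero_add as_sign_locally_zero) (simp_all add: add_ac)
  with c show ?thesis by (simp add: as_cocycles_def as_cochain_cup_cochain)
qed

lemma as_cochain_cup_coboundary_left: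
  assumes \<phi>: "\<phi> \<in> as_coboundaries p X" and \<psi>: "\<psi> \<in> as_cocycles q X"
  shows "as_cochain_cup p q \<phi> \<psi> \<in> as_coboundaries (p + q) X"
proof (cases p)
  case 0
  have "as_cochain_cup p q \<phi> \<psi> \<in> as_locally_zero (p + q) X"
    using assms 0 by (intro as_cochain_cup_locally_zero) (auto simp: as_cocycles_def as_locally_zero_cochain)
  then show ?thesis using as_locally_zero_subset_coboundaries by blast
next
  case (Suc r)
  with \<phi> obtain \<theta> where c: "\<phi> \<in> as_cochains p X" "\<theta> \<in> as_cochains r X"
    "(\<lambda>xs. \<phi> xs - as_delta r X \<theta> xs) \<in> as_locally_zero p X" by auto
  have d: "\<psi> \<in> as_cochains q X" "as_delta q X \<psi> \<in> as_locally_zero (q + 1) X"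
    using \<psi> by (auto simp: as_cocycles_def)
  have "as_cochain_cup p q (\<lambda>xs. \<phi> xs - as_delta r X \<theta> xs) \<psi> \<in> as_locally_zero (p + q) X"
    using c d by (intro as_cochain_cup_locally_zero) (auto simp: as_locally_zero_cochain)
  moreover have "(\<lambda>xs. as_sign r (as_cochain_cup r (q + 1) \<theta> (as_delta q X \<psi>) xs)) \<in> as_locally_zero (r + (q + 1)) X"
    using c d by (intro as_sign_locally_zero as_cochain_cup_locally_zero) (auto simp: as_locally_zero_cochain)
  ultimately have "(\<lambda>xs. as_cochain_cup p q (\<lambda>xs. \<phi> xs - as_delta r X \<theta> xs) \<psi> xs -
      as_sign r (as_cochain_cup r (q + 1) \<theta> (as_delta q X \<psi>) xs)) \<in> as_locally_zero (p + q) X"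
    using Suc by (intro as_locally_zero_diff) simp_all
  moreover have "as_cochain_cup p q (\<lambda>xs. \<phi> xs - as_delta r X \<theta> xs) \<psi> xs =
     as_cochain_cup p q \<phi> \<psi> xs - as_cochain_cup (r + 1) q (as_delta r X \<theta>) \<psi> xs" for xs
    using Suc by (simp add: as_cochain_cup_def left_diff_distrib)
  ultimately have "(\<lambda>xs. as_cochain_cup p q \<phi> \<psi> xs - as_delta (r + q) X (as_cochain_cup r q \<theta> \<psi>) xs)
      \<in> as_locally_zero (p + q) X"
    unfolding as_delta_cochain_cup[OF c(2) d(1)] by (simp add: diff_diff_eq)
  moreover have "as_cochain_cup p q \<phi> \<psi> \<in> as_cochains (p + q) X"
    "as_cochain_cup r q \<theta> \<psi> \<in> as_cochains (r + q) X"
    using c d by (auto intro: as_cochain_cup_cochain)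
  ultimately show ?thesis using Suc by auto
qed

lemma as_cochain_cup_coboundary_right:
  assumes \<phi>: "\<phi> \<in> as_cocycles p X" and \<psi>: "\<psi> \<in> as_coboundaries q X"
  shows "as_cochain_cup p q \<phi> \<psi> \<in> as_coboundaries (p + q) X"
proof (cases q)
  case 0
  have "as_cochain_cup p q \<phi> \<psi> \<in> as_locally_zero (p + q) X"
    using assms 0 by (intro as_cochain_cup_locally_zero) (auto simp: as_cocycles_def as_locally_zero_cochain)
  then show ?thesis using as_locally_zero_subset_coboundaries by blast
next
  case (Suc r)
  with \<psi> obtain \<theta> where c: "\<psi> \<in> as_cochains q X" "\<theta> \<in> as_cochains r X"
    "(\<lambda>xs. \<psi> xs - as_delta r X \<theta> xs) \<in> as_locally_zero q X" by auto
  have d: "\<phi> \<in> as_cochains p X" "as_delta p X \<phi> \<in> as_locally_zero (p + 1) X"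
    using \<phi> by (auto simp: as_cocycles_def)
  let ?u = "as_cochain_cup (p + 1) r (as_delta p X \<phi>) \<theta>"
    and ?v = "as_cochain_cup p q \<phi> (as_delta r X \<theta>)"
  have "as_cochain_cup p q \<phi> (\<lambda>xs. \<psi> xs - as_delta r X \<theta> xs) \<in> as_locally_zero (p + q) X"
    using c d by (intro as_cochain_cup_locally_zero) (auto simp: as_locally_zero_cochain)
  moreover have "(\<lambda>xs. as_sign p (?u xs)) \<in> as_locally_zero (p + 1 + r) X"
    using c d by (intro as_sign_locally_zero as_cochain_cup_locally_zero) (auto simp: as_locally_zero_cochain)
  ultimately have "(\<lambda>xs. as_cochain_cup p q \<phi> (\<lambda>xs. \<psi> xs - as_delta r X \<theta> xs) xs - as_sign p (?u xs))
     \<in> as_locally_zero (p + q) X"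
    using Suc by (intro as_locally_zero_diff) simp_all
  moreover have "as_cochain_cup p q \<phi> (\<lambda>xs. \<psi> xs - as_delta r X \<theta> xs) xs = as_cochain_cup p q \<phi> \<psi> xs - ?v xs" for xs
    by (simp add: as_cochain_cup_def right_diff_distrib)
  moreover have "as_delta (p + r) X (\<lambda>xs. as_sign p (as_cochain_cup p r \<phi> \<theta> xs)) xs = as_sign p (?u xs) + ?v xs" for xs
    using fun_cong[OF as_delta_cochain_cup[OF d(1) c(2)], of xs] Suc
    by (cases "even p") (simp_all add: as_sign_def as_delta_uminus)
  ultimately have "(\<lambda>xs. as_cochain_cup p q \<phi> \<psi> xs -
      as_delta (p + r) X (\<lambda>xs. as_sign p (as_cochain_cup p r \<phi> \<theta> xs)) xs) \<in> as_locally_zero (p + q) X"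
    by (simp add: algebra_simps)
  moreover have "as_cochain_cup p q \<phi> \<psi> \<in> as_cochains (p + q) X"
    "(\<lambda>xs. as_sign p (as_cochain_cup p r \<phi> \<theta> xs)) \<in> as_cochains (p + r) X"
    using as_cochain_cup_cochain[OF d(1) c(1)] as_cochain_cup_cochain[OF d(1) c(2)]
      as_cochains_uminus[OF as_cochain_cup_cochain[OF d(1) c(2)]]
    by (cases "even p"; simp add: as_sign_def)+
  ultimately show ?thesis using Suc by auto
qed

lemma as_cup_class:
  assumes \<phi>: "\<phi> \<in> as_cocycles p X" and \<psi>: "\<psi> \<in> as_cocycles q X"
  shows "as_cup p q X (as_class p X \<phi>) (as_class q X \<psi>) = as_class (p + q) X (as_cochain_cup p q \<phi> \<psi>)"
proof -
  have "as_class (p + q) X (as_cochain_cup p q \<phi>' \<psi>') = as_class (p + q) X (as_cochain_cup p q \<phi> \<psi>)"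
    if "\<phi>' \<in> as_class p X \<phi>" "\<psi>' \<in> as_class q X \<psi>" for \<phi>' \<psi>'
  proof -
    have b: "(\<lambda>xs. \<phi>' xs - \<phi> xs) \<in> as_coboundaries p X" "(\<lambda>xs. \<psi>' xs - \<psi> xs) \<in> as_coboundaries q X"
      using that by (auto simp: as_class_iff)
    then have "(\<lambda>xs. (\<psi>' xs - \<psi> xs) + \<psi> xs) \<in> as_cocycles q X"
      using \<psi> as_coboundaries_subset_cocycles by (intro as_cocycles_add) blast+
    then have \<psi>': "\<psi>' \<in> as_cocycles q X" by simp
    from as_coboundaries_add[OF as_cochain_cup_coboundary_left[OF b(1) \<psi>']
        as_cochain_cup_coboundary_right[OF \<phi> b(2)]]
    have "(\<lambda>xs. as_cochain_cup p q \<phi>' \<psi>' xs - as_cochain_cup p q \<phi> \<psi> xs) \<in> as_coboundaries (p + q) X"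
      by (rule back_subst[where P = "\<lambda>\<theta>. \<theta> \<in> _"])
        (auto simp: as_cochain_cup_def left_diff_distrib right_diff_distrib)
    then show ?thesis by (simp add: as_class_eq_iff)
  qed
  then show ?thesis
    unfolding as_cup_def using as_class_self[of \<phi> p X] as_class_self[of \<psi> q X] by blast
qed

end

theory Submission
  imports Defs
begin

text \<open>
Suppose that \<open>s\<close> is a motion planner with values in resolvable paths of measures with at most two
atoms. It divides \<open>X\<^sup>m\<close> into the closed set \<open>A\<close> of those \<open>x\<close> for which all \<open>s x t\<close> are Dirac measures and
its open complement \<open>C\<close>. On each of these sets the unordered pair of atoms of \<open>s x t\<close> is continuous
in \<open>x\<close> and \<open>t\<close>. An obstruction arises only if the weight of an atom tends to zero, as the
Levy--Prokhorov metric does not see light atoms (\<open>continuous_map_support_pair\<close>). On \<open>A\<close> the weights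
are 1. On \<open>C\<close> they are locally bounded below: near a time with two atoms this holds by continuity,
and resolvability carries the bound to all times (\<open>resolvable_path_weights\<close>).

The pair of atoms of \<open>s x t\<close> is a path in the symmetric square that passes through \<open>[x\<^sub>i, x\<^sub>i]\<close> at the
time \<open>t\<^sub>i\<close>. Contracting the times \<open>t\<^sub>i\<close> to 0 therefore deforms \<open>sq_diag\<close>, on \<open>A\<close> and on \<open>C\<close>, into a map with
values in the diagonal (\<open>homotopic_to_diagonal_pullback_coboundary\<close>). Hence the two given classes
vanish on \<open>A\<close> and on \<open>C\<close>. By tautness the first one vanishes on an open neighbourhood of \<open>A\<close>
(\<open>as_coboundary_near_closed_subset\<close>). This neighbourhood and \<open>C\<close> cover \<open>X\<^sup>m\<close>, so the cup product is
zero (\<open>as_cup_coboundary_if_open_cover\<close>), as in the theory of Lusternik--Schnirelmann category.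

The homotopy invariance and the tautness of Alexander--Spanier cohomology both follow from one
fact: maps that send small sets into a common small set have cohomologous pullbacks
(\<open>contiguous_pullbacks_cohomologous\<close>). Since cochains are arbitrary functions of tuples of points, it
also applies to discontinuous maps.
\<close>

section \<open>The prism operator on Alexander--Spanier cochains\<close>

text \<open>
The alternating sum over all faces of a simplex, computed by splitting off the first vertex. In
this form the coboundary of the prism operator below can be found by induction on the list.
\<close>

primrec alt_faces :: "('a list \<Rightarrow> 'r::ab_group_add) \<Rightarrow> 'a list \<Rightarrow> 'r" where
  "alt_faces \<phi> [] = 0"
| "alt_faces \<phi> (x # xs) = \<phi> xs - alt_faces (\<lambda>l. \<phi> (x # l)) xs"

text \<open>
On a simplex \<open>x\<^sub>0, \<dots>, x\<^sub>p\<close> this is the alternating sum over \<open>i\<close> of the values of \<open>\<phi>\<close> on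
\<open>f x\<^sub>0, \<dots>, f x\<^sub>i, g x\<^sub>i, \<dots>, g x\<^sub>p\<close>: the usual triangulation of the prism between the images under \<open>f\<close>
and \<open>g\<close>.
\<close>

primrec prism :: "('a \<Rightarrow> 'b) \<Rightarrow> ('a \<Rightarrow> 'b) \<Rightarrow> ('b list \<Rightarrow> 'r::ab_group_add) \<Rightarrow> 'a list \<Rightarrow> 'r" where
  "prism f g \<phi> [] = 0"
| "prism f g \<phi> (x # xs) = \<phi> (f x # g x # map g xs) - prism f g (\<lambda>l. \<phi> (f x # l)) xs"

lemma alt_faces_eq_sum: "alt_faces \<phi> xs = (\<Sum>i<length xs. as_sign i (\<phi> (as_face i xs)))"
proof (induction xs arbitrary: \<phi>)
  case (Cons x xs)
  have "(\<Sum>i<length (x # xs). as_sign i (\<phi> (as_face i (x # xs)))) =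
      \<phi> xs + (\<Sum>i<length xs. - as_sign i (\<phi> (x # as_face i xs)))"
    by (simp only: list.size sum.lessThan_Suc_shift add_Suc_right add_0_right) (auto simp: as_face_def as_sign_def intro!: sum.cong)
  then show ?case using Cons[of "\<lambda>l. \<phi> (x # l)"] by (simp add: sum_negf)
qed simp

lemma as_delta_eq_alt_faces:
  assumes "length xs = p + 2" "set xs \<subseteq> topspace X"
  shows "as_delta p X \<phi> xs = alt_faces \<phi> xs"
  using assms by (simp add: as_delta_apply alt_faces_eq_sum lessThan_Suc_atMost del: sum.atMost_Suc sum.lessThan_Suc)

lemma alt_faces_add: "alt_faces (\<lambda>l. \<phi> l + \<psi> l) xs = alt_faces \<phi> xs + alt_faces \<psi> xs"
  by (simp add: alt_faces_eq_sum as_sign_add sum.distrib)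

lemma alt_faces_diff: "alt_faces (\<lambda>l. \<phi> l - \<psi> l) xs = alt_faces \<phi> xs - alt_faces \<psi> xs"
  using alt_faces_add[of "\<lambda>l. \<phi> l - \<psi> l" \<psi> xs] by simp

lemma alt_faces_zero: "alt_faces (\<lambda>l. 0) xs = 0"
  by (simp add: alt_faces_eq_sum)

lemma alt_faces_sum: "alt_faces (\<lambda>l. \<Sum>j<(K::nat). \<phi> j l) xs = (\<Sum>j<K. alt_faces (\<phi> j) xs)"
  by (induction K) (simp_all add: alt_faces_zero alt_faces_add)

lemma alt_faces_map: "alt_faces (\<lambda>l. \<phi> (map g l)) xs = alt_faces \<phi> (map g xs)"
  by (simp add: alt_faces_eq_sum map_as_face)

lemma prism_diff: "prism f g (\<lambda>l. \<phi> l - \<psi> l) xs = prism f g \<phi> xs - prism f g \<psi> xs"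
  by (induction xs arbitrary: \<phi> \<psi>) (simp_all add: algebra_simps)

lemma prism_cong:
  assumes "\<And>x. x \<in> set xs \<Longrightarrow> g x = h x"
  shows "prism f g \<phi> xs = prism f h \<phi> xs"
  using assms
proof (induction xs arbitrary: \<phi>)
  case (Cons x xs)
  then have "map g xs = map h xs" "g x = h x" by auto
  with Cons show ?case by (simp only: prism.simps) simp
qed simp

lemma prism_eq_0:
  assumes "\<And>l. length l = Suc (length xs) \<Longrightarrow> set l \<subseteq> f ` set xs \<union> g ` set xs \<Longrightarrow> \<phi> l = 0"
  shows "prism f g \<phi> xs = 0"
  using assms
proof (induction xs arbitrary: \<phi>)
  case (Cons x xs)
  have "prism f g (\<lambda>l. \<phi> (f x # l)) xs = 0" by (rule Cons.IH, rule Cons.prems) auto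
  moreover have "\<phi> (f x # g x # map g xs) = 0" by (rule Cons.prems) auto
  ultimately show ?case by simp
qed simp

text \<open>
The boundary of a prism consists of its top, its bottom, and the prism over the boundary.
\<close>

lemma alt_faces_prism:
  "alt_faces (prism f g \<phi>) xs + prism f g (alt_faces \<phi>) xs = \<phi> (map g xs) - \<phi> (map f xs)"
proof (induction xs arbitrary: \<phi>)
  case (Cons x xs)
  let ?\<phi>f = "\<lambda>l. \<phi> (f x # l)"
  let ?B = "alt_faces (\<lambda>l. \<phi> (f x # g x # l)) (map g xs)"
  have "alt_faces (prism f g \<phi>) (x # xs) = prism f g \<phi> xs - (?B - alt_faces (prism f g ?\<phi>f) xs)"
    by (simp add: alt_faces_diff alt_faces_map[where \<phi> = "\<lambda>l. \<phi> (f x # g x # l)"])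
  moreover have "prism f g (alt_faces \<phi>) (x # xs) =
      \<phi> (g x # map g xs) - (\<phi> (f x # map g xs) - ?B) - (prism f g \<phi> xs - prism f g (alt_faces ?\<phi>f) xs)"
    by (simp add: prism_diff)
  ultimately show ?case using Cons.IH[of ?\<phi>f] by (simp add: algebra_simps)
qed simp

text \<open>
If two maps send small sets into a common small set, then on small simplices the coboundary of the
prism of a cocycle is the difference of its pullbacks, as the cocycle condition applies to the
whole prism. Discontinuous maps are included, because Alexander--Spanier cochains are
arbitrary functions of tuples of points. The sequence becomes stationary at each point after a
number of steps that may be unbounded over the space; this covers homotopies over noncompact spaces
as well as discontinuous retractions.
\<close>

lemma contiguous_pullbacks_cohomologous:
  fixes f :: "nat \<Rightarrow> 'a \<Rightarrow> 'b" and \<phi> :: "'b list \<Rightarrow> 'r::ab_group_add"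
  assumes \<phi>: "\<phi> \<in> as_cochains (Suc q) Y"
    and im: "\<And>j x. x \<in> topspace X \<Longrightarrow> f j x \<in> topspace Y"
    and stop: "\<And>j x. x \<in> topspace X \<Longrightarrow> n x \<le> j \<Longrightarrow> f j x = g x"
    and small: "\<And>x. x \<in> topspace X \<Longrightarrow> \<exists>V. openin X V \<and> x \<in> V \<and>
      (\<forall>j. \<exists>U. (\<forall>l. set l \<subseteq> U \<longrightarrow> as_delta (Suc q) Y \<phi> l = 0) \<and> f j ` V \<union> f (Suc j) ` V \<subseteq> U)"
  shows "(\<lambda>xs. as_pullback X g \<phi> xs - as_pullback X (f 0) \<phi> xs) \<in> as_coboundaries (Suc q) X"
proof -
  \<comment> \<open>The prism from \<open>f j\<close> to itself is subtracted: it does not change the coboundary formula, and it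
    makes the summand vanish on all simplices on which the sequence is already stationary. So the
    sum over all \<open>j\<close> is finite on each simplex.\<close>
  define P where "P j xs = prism (f j) (f (Suc j)) \<phi> xs - prism (f j) (f j) \<phi> xs" for j xs
  \<comment> \<open>Any bound for \<open>n\<close> on the vertices would do; a sum over the list needs no case for the empty list.\<close>
  define N where "N xs = sum_list (map n xs)" for xs :: "'a list"
  define \<theta> where "\<theta> xs = (if length xs = Suc q \<and> set xs \<subseteq> topspace X then \<Sum>j<N xs. P j xs else 0)" for xs
  have P0: "P j xs = 0" if "set xs \<subseteq> topspace X" "\<And>x. x \<in> set xs \<Longrightarrow> n x \<le> j" for j xs
  proof -
    have "f (Suc j) x = f j x" if "x \<in> set xs" for x
      using stop[of x j] stop[of x "Suc j"] \<open>set xs \<subseteq> topspace X\<close> that \<open>\<And>x. x \<in> set xs \<Longrightarrow> n x \<le> j\<close>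
      by (metis le_SucI subsetD)
    then show ?thesis unfolding P_def by (simp add: prism_cong[of xs "f (Suc j)" "f j"])
  qed
  have N: "n x \<le> N xs" if "x \<in> set xs" for x xs
    unfolding N_def using that by (simp add: member_le_sum_list)
  have \<theta>: "\<theta> xs = (\<Sum>j<K. P j xs)"
    if "length xs = Suc q" "set xs \<subseteq> topspace X" "\<And>x. x \<in> set xs \<Longrightarrow> n x \<le> K" for xs K
  proof -
    have "(\<Sum>j<N xs. P j xs) = (\<Sum>j<K + N xs. P j xs)"
      by (rule sum.mono_neutral_left) (use that(2) in \<open>auto intro!: P0 order_trans[OF N]\<close>)
    also have "\<dots> = (\<Sum>j<K. P j xs)"
      by (rule sum.mono_neutral_right) (use that(2) in \<open>auto intro!: P0 order_trans[OF that(3)]\<close>)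
    finally show ?thesis using that by (simp add: \<theta>_def)
  qed
  have cobound: "(\<lambda>xs. as_pullback X g \<phi> xs - as_pullback X (f 0) \<phi> xs) \<in> as_cochains (Suc q) X"
    by (intro as_cochains_diff as_pullback_cochain[OF \<phi>])
  have "(\<lambda>xs. as_pullback X g \<phi> xs - as_pullback X (f 0) \<phi> xs - as_delta q X \<theta> xs) \<in> as_locally_zero (Suc q) X"
  proof (rule as_locally_zeroI)
    show "(\<lambda>xs. as_pullback X g \<phi> xs - as_pullback X (f 0) \<phi> xs - as_delta q X \<theta> xs) \<in> as_cochains (Suc q) X"
      using as_delta_cochain[of q X \<theta>] by (intro as_cochains_diff as_pullback_cochain[OF \<phi>]) simp
  next
    fix x assume "x \<in> topspace X"
    from small[OF this] obtain V where V: "openin X V" "x \<in> V" and small_V: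
      "\<And>j. \<exists>U. (\<forall>l. set l \<subseteq> U \<longrightarrow> as_delta (Suc q) Y \<phi> l = 0) \<and> f j ` V \<union> f (Suc j) ` V \<subseteq> U"
      by blast
    have sub: "V \<subseteq> topspace X" using V(1) by (rule openin_subset)
    have "as_pullback X g \<phi> xs - as_pullback X (f 0) \<phi> xs = as_delta q X \<theta> xs" if xs: "set xs \<subseteq> V" for xs
    proof (cases "length xs = q + 2")
      case False
      have "as_pullback X g \<phi> xs = 0" "as_pullback X (f 0) \<phi> xs = 0"
        by (rule as_cochains_outside[OF as_pullback_cochain[OF \<phi>]]; use False in simp)+
      with False show ?thesis by (simp add: as_delta_outside)
    next
      case True
      have xs': "set xs \<subseteq> topspace X" using xs sub by blast
      let ?K = "N xs"
      have P_homotopy: "alt_faces (P j) xs = \<phi> (map (f (Suc j)) xs) - \<phi> (map (f j) xs)" for j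
      proof -
        obtain U where U: "\<And>l. set l \<subseteq> U \<Longrightarrow> as_delta (Suc q) Y \<phi> l = 0" "f j ` V \<union> f (Suc j) ` V \<subseteq> U"
          using small_V[of j] by blast
        have "prism h h' (alt_faces \<phi>) xs = 0" if hh: "{h, h'} \<subseteq> {f j, f (Suc j)}" for h h'
        proof (rule prism_eq_0)
          fix l assume l: "length l = Suc (length xs)" "set l \<subseteq> h ` set xs \<union> h' ` set xs"
          then have "set l \<subseteq> f j ` set xs \<union> f (Suc j) ` set xs" using hh by auto
          moreover have "f j ` set xs \<union> f (Suc j) ` set xs \<subseteq> f j ` V \<union> f (Suc j) ` V"
            using xs by (intro Un_mono image_mono)
          moreover have "f j ` set xs \<union> f (Suc j) ` set xs \<subseteq> topspace Y"
            using xs' im by auto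
          ultimately have "set l \<subseteq> U" "set l \<subseteq> topspace Y" using U(2) by (meson order_trans)+
          with l(1) True U(1)[of l] show "alt_faces \<phi> l = 0" by (simp add: as_delta_eq_alt_faces)
        qed
        from this[of "f j" "f j"] this[of "f j" "f (Suc j)"]
          alt_faces_prism[of "f j" "f (Suc j)" \<phi> xs] alt_faces_prism[of "f j" "f j" \<phi> xs]
        show ?thesis by (simp add: P_def [abs_def] alt_faces_diff)
      qed
      have "as_delta q X \<theta> xs = alt_faces \<theta> xs"
        using True xs' by (simp add: as_delta_eq_alt_faces)
      also have "\<dots> = alt_faces (\<lambda>l. \<Sum>j<?K. P j l) xs"
        unfolding alt_faces_eq_sum
      proof (intro sum.cong refl arg_cong[where f = "as_sign _"] \<theta>)
        fix i assume "i \<in> {..<length xs}"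
        then show "length (as_face i xs) = Suc q" using True by (simp add: length_as_face)
        show "set (as_face i xs) \<subseteq> topspace X" using set_as_face_subset[of i xs] xs' by blast
        show "n y \<le> ?K" if "y \<in> set (as_face i xs)" for y
          using set_as_face_subset[of i xs] N[of y xs] that by blast
      qed
      also have "\<dots> = (\<Sum>j<?K. \<phi> (map (f (Suc j)) xs) - \<phi> (map (f j) xs))"
        by (simp add: alt_faces_sum P_homotopy)
      also have "\<dots> = \<phi> (map (f ?K) xs) - \<phi> (map (f 0) xs)"
        by (rule sum_lessThan_telescope)
      also have "map (f ?K) xs = map g xs"
        using xs' by (auto intro!: stop N)
      finally show ?thesis using xs' by (simp add: as_pullback_def)
    qed
    with V show "\<exists>U. openin X U \<and> x \<in> U \<and> (\<forall>xs. set xs \<subseteq> U \<longrightarrow>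
        as_pullback X g \<phi> xs - as_pullback X (f 0) \<phi> xs - as_delta q X \<theta> xs = 0)"
      by (intro exI[of _ V]) simp
  qed
  moreover have "\<theta> \<in> as_cochains q X"
    by (rule as_cochainsI) (auto simp: \<theta>_def split: if_splits)
  ultimately show ?thesis using cobound by auto
qed

section \<open>Homotopy invariance\<close>

lemma as_cocycle_small_simplices:
  assumes "\<phi> \<in> as_cocycles p X" "x \<in> topspace X"
  obtains U where "openin X U" "x \<in> U" "\<And>l. set l \<subseteq> U \<Longrightarrow> as_delta p X \<phi> l = 0"
proof -
  have "as_delta p X \<phi> \<in> as_locally_zero (p + 1) X" using assms(1) by (simp add: as_cocycles_def)
  then show ?thesis using assms(2) by (rule as_locally_zeroE) (rule that)
qed

text \<open>
Over a noncompact base no single Lebesgue number works for all fibres \<open>{x} \<times> [0,1]\<close>. The supremum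
of the admissible numbers at \<open>x\<close> is positive since the fibre is compact, and it is 1-Lipschitz since
a ball around \<open>y\<close> lies in the ball around \<open>x\<close> whose radius is larger by the distance.
\<close>

lemma Lebesgue_function_on_unit_interval:
  fixes H :: "'a \<times> real \<Rightarrow> 'b"
  assumes "Metric_space M d"
    and H: "continuous_map (prod_topology (Metric_space.mtopology M d) (top_of_set {0..1})) Y H"
    and \<U>: "\<And>y. y \<in> topspace Y \<Longrightarrow> \<exists>U\<in>\<U>. openin Y U \<and> y \<in> U"
  obtains \<epsilon> :: "'a \<Rightarrow> real" where "\<And>x. x \<in> M \<Longrightarrow> 0 < \<epsilon> x"
    and "\<And>x y. x \<in> M \<Longrightarrow> y \<in> M \<Longrightarrow> \<epsilon> x \<le> \<epsilon> y + d x y"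
    and "\<And>x r t. x \<in> M \<Longrightarrow> r < \<epsilon> x \<Longrightarrow> t \<in> {0..1} \<Longrightarrow>
      \<exists>U\<in>\<U>. \<forall>y\<in>M. \<forall>s\<in>{0..1}. d x y < r \<longrightarrow> \<bar>s - t\<bar> < r \<longrightarrow> H (y, s) \<in> U"
proof -
  interpret Metric_space M d by fact
  define good where "good x r \<longleftrightarrow> r \<le> 1 \<and> (\<forall>t\<in>{0..1}. \<exists>U\<in>\<U>. \<forall>y\<in>M. \<forall>s\<in>{0..1}.
      d x y < r \<longrightarrow> \<bar>s - t\<bar> < r \<longrightarrow> H (y, s) \<in> U)" for x r
  define \<epsilon> where "\<epsilon> x = Sup (Collect (good x))" for x
  have exists_good: "\<exists>r>0. good x r" if x: "x \<in> M" for x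
  proof -
    have "\<exists>\<rho>>0. \<exists>U\<in>\<U>. \<forall>y\<in>M. \<forall>s\<in>{0..1}. d x y < \<rho> \<longrightarrow> \<bar>s - t\<bar> < \<rho> \<longrightarrow> H (y, s) \<in> U"
      if t: "t \<in> {0..1}" for t
    proof -
      have "H (x, t) \<in> topspace Y"
        using continuous_map_image_subset_topspace[OF H] x t by auto
      then obtain U where U: "U \<in> \<U>" "openin Y U" "H (x, t) \<in> U" using \<U> by blast
      have "openin (prod_topology mtopology (top_of_set {0..1})) {z \<in> M \<times> {0..1}. H z \<in> U}"
        using openin_continuous_map_preimage[OF H U(2)] by simp
      moreover have "(x, t) \<in> {z \<in> M \<times> {0..1}. H z \<in> U}" using x t U by simp
      ultimately obtain V W where VW: "openin mtopology V" "openin (top_of_set {0..1}) W" "x \<in> V" "t \<in> W"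
        "V \<times> W \<subseteq> {z \<in> M \<times> {0..1}. H z \<in> U}"
        unfolding openin_prod_topology_alt by meson
      obtain r1 where r1: "r1 > 0" "mball x r1 \<subseteq> V" using VW(1,3) unfolding openin_mtopology by meson
      obtain r2 where r2: "r2 > 0" "ball t r2 \<inter> {0..1} \<subseteq> W"
        using VW(2,4) unfolding openin_contains_ball by blast
      have "H (y, s) \<in> U" if "y \<in> M" "s \<in> {0..1}" "d x y < min r1 r2" "\<bar>s - t\<bar> < min r1 r2" for y s
      proof -
        have "y \<in> V" using r1 that x by auto
        moreover have "s \<in> W" using r2 that by (auto simp: dist_real_def abs_minus_commute)
        ultimately show ?thesis using VW(5) by blast
      qed
      then show ?thesis using r1(1) r2(1) U(1) by (intro exI[of _ "min r1 r2"] conjI bexI[of _ U]) auto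
    qed
    then obtain \<rho> where \<rho>: "\<And>t. t \<in> {0..1} \<Longrightarrow> \<rho> t > 0"
      "\<And>t. t \<in> {0..1} \<Longrightarrow> \<exists>U\<in>\<U>. \<forall>y\<in>M. \<forall>s\<in>{0..1}. d x y < \<rho> t \<longrightarrow> \<bar>s - t\<bar> < \<rho> t \<longrightarrow> H (y, s) \<in> U"
      by metis
    have cover: "{0..1} \<subseteq> (\<Union>t\<in>{0..1::real}. ball t (\<rho> t / 2))" using \<rho>(1) by force
    obtain F where F: "finite F" "F \<subseteq> {0..1}" "{0..1} \<subseteq> (\<Union>t\<in>F. ball t (\<rho> t / 2))"
      by (rule compactE_image[OF compact_Icc _ cover]) auto
    define r where "r = Min (insert 1 ((\<lambda>t. \<rho> t / 2) ` F))"
    have r_le: "r \<le> 1" "\<And>t. t \<in> F \<Longrightarrow> r \<le> \<rho> t / 2"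
      unfolding r_def by (rule Min_le; use F(1) in simp)+
    have "r > 0" unfolding r_def using F(1,2) \<rho>(1) by auto
    moreover have "good x r" unfolding good_def
    proof (intro conjI ballI r_le(1))
      fix t :: real assume "t \<in> {0..1}"
      then obtain u where u: "u \<in> F" "\<bar>u - t\<bar> < \<rho> u / 2" using F(3) by (auto simp: dist_real_def)
      then obtain U where U: "U \<in> \<U>"
        "\<forall>y\<in>M. \<forall>s\<in>{0..1}. d x y < \<rho> u \<longrightarrow> \<bar>s - u\<bar> < \<rho> u \<longrightarrow> H (y, s) \<in> U"
        using \<rho>(2) F(2) by blast
      have "H (y, s) \<in> U" if "y \<in> M" "s \<in> {0..1}" "d x y < r" "\<bar>s - t\<bar> < r" for y s
      proof -
        have "d x y < \<rho> u" "\<bar>s - u\<bar> < \<rho> u"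
          using that u r_le(2)[OF u(1)] nonneg[of x y] by linarith+
        with U(2) that(1,2) show ?thesis by simp
      qed
      with U(1) show "\<exists>U\<in>\<U>. \<forall>y\<in>M. \<forall>s\<in>{0..1}. d x y < r \<longrightarrow> \<bar>s - t\<bar> < r \<longrightarrow> H (y, s) \<in> U"
        by (intro bexI[of _ U]) simp_all
    qed
    ultimately show ?thesis by blast
  qed
  have bdd: "bdd_above (Collect (good x))" for x by (rule bdd_aboveI[of _ 1]) (simp add: good_def)
  have le_\<epsilon>: "r \<le> \<epsilon> x" if "good x r" for x r
    unfolding \<epsilon>_def by (rule cSup_upper) (use that bdd in auto)
  have good_mono: "good x r" if "good x r'" "r \<le> r'" for x r r'
    using that unfolding good_def by (meson less_le_trans order_trans)
  have good_below: "good x r" if x: "x \<in> M" and r: "r < \<epsilon> x" for x r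
  proof -
    have "Collect (good x) \<noteq> {}" using exists_good[OF x] by auto
    then obtain r' where "good x r'" "r < r'" using r bdd[of x] unfolding \<epsilon>_def by (auto simp: less_cSup_iff)
    then show ?thesis using good_mono by auto
  qed
  show thesis
  proof (rule that)
    show "0 < \<epsilon> x" if "x \<in> M" for x using exists_good[OF that] le_\<epsilon> by (meson less_le_trans)
    show "\<exists>U\<in>\<U>. \<forall>y\<in>M. \<forall>s\<in>{0..1}. d x y < r \<longrightarrow> \<bar>s - t\<bar> < r \<longrightarrow> H (y, s) \<in> U"
      if "x \<in> M" "r < \<epsilon> x" "t \<in> {0..1}" for x r t
      using good_below[OF that(1,2)] that(3) unfolding good_def by blast
    show "\<epsilon> x \<le> \<epsilon> y + d x y" if xy: "x \<in> M" "y \<in> M" for x y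
    proof (rule dense_le)
      fix r assume "r < \<epsilon> x"
      then have r: "good x r" using good_below xy by blast
      have "good y (r - d x y)" unfolding good_def
      proof (intro conjI ballI)
        show "r - d x y \<le> 1" using r nonneg[of x y] unfolding good_def by linarith
        fix t :: real assume "t \<in> {0..1}"
        then obtain U where U: "U \<in> \<U>" "\<forall>z\<in>M. \<forall>s\<in>{0..1}. d x z < r \<longrightarrow> \<bar>s - t\<bar> < r \<longrightarrow> H (z, s) \<in> U"
          using r unfolding good_def by blast
        have "H (z, s) \<in> U" if z: "z \<in> M" "s \<in> {0..1}" "d y z < r - d x y" "\<bar>s - t\<bar> < r - d x y" for z s
        proof -
          have "d x z < r" using triangle[OF xy z(1)] z(3) by linarith
          moreover have "\<bar>s - t\<bar> < r" using z(4) nonneg[of x y] by linarith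
          ultimately show ?thesis using U(2) z by blast
        qed
        then show "\<exists>U\<in>\<U>. \<forall>z\<in>M. \<forall>s\<in>{0..1}. d y z < r - d x y \<longrightarrow> \<bar>s - t\<bar> < r - d x y \<longrightarrow> H (z, s) \<in> U"
          using U(1) by blast
      qed
      from le_\<epsilon>[OF this] show "r \<le> \<epsilon> y + d x y" by linarith
    qed
  qed
qed

text \<open>
The homotopy is cut into steps that are short compared with the Lebesgue
number \<open>\<epsilon> x\<close> at each point: after \<open>j\<close> steps the time is \<open>min 1 (j * \<epsilon> x / 4)\<close>. It reaches 1 after finitely
many steps at each point, and consecutive stages are contiguous in the sense of the prism lemma.
\<close>

lemma homotopic_pullbacks_cohomologous:
  fixes H :: "'a \<times> real \<Rightarrow> 'b" and \<phi> :: "'b list \<Rightarrow> 'r::ab_group_add"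
  assumes X: "metrizable_space X"
    and H: "continuous_map (prod_topology X (top_of_set {0..1})) Y H"
    and \<phi>: "\<phi> \<in> as_cocycles (Suc q) Y"
  shows "(\<lambda>xs. as_pullback X (\<lambda>x. H (x, 1)) \<phi> xs - as_pullback X (\<lambda>x. H (x, 0)) \<phi> xs)
    \<in> as_coboundaries (Suc q) X"
proof -
  obtain M d where Md: "Metric_space M d" and X_eq: "X = Metric_space.mtopology M d"
    using X unfolding metrizable_space_def by blast
  interpret Metric_space M d by fact
  define \<U> where "\<U> = {U. \<forall>l. set l \<subseteq> U \<longrightarrow> as_delta (Suc q) Y \<phi> l = 0}"
  have "\<exists>U\<in>\<U>. openin Y U \<and> y \<in> U" if y: "y \<in> topspace Y" for y
  proof -
    obtain U where "openin Y U" "y \<in> U" "\<And>l. set l \<subseteq> U \<Longrightarrow> as_delta (Suc q) Y \<phi> l = 0"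
      by (rule as_cocycle_small_simplices[OF \<phi> y]) (rule that)
    then show ?thesis unfolding \<U>_def by (intro bexI[of _ U]) simp_all
  qed
  then obtain \<epsilon> :: "'a \<Rightarrow> real" where pos: "\<And>x. x \<in> M \<Longrightarrow> 0 < \<epsilon> x"
    and lip: "\<And>x y. x \<in> M \<Longrightarrow> y \<in> M \<Longrightarrow> \<epsilon> x \<le> \<epsilon> y + d x y"
    and small: "\<And>x r t. x \<in> M \<Longrightarrow> r < \<epsilon> x \<Longrightarrow> t \<in> {0..1} \<Longrightarrow>
      \<exists>U\<in>\<U>. \<forall>y\<in>M. \<forall>s\<in>{0..1}. d x y < r \<longrightarrow> \<bar>s - t\<bar> < r \<longrightarrow> H (y, s) \<in> U"
    by (rule Lebesgue_function_on_unit_interval[OF Md H[unfolded X_eq], of \<U>]) (assumption, rule that)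
  define h where "h j x = min 1 (real j * \<epsilon> x / 4)" for j x
  define n where "n x = nat \<lceil>4 / \<epsilon> x\<rceil>" for x
  have h01: "h j x \<in> {0..1}" if "x \<in> M" for j x using pos[OF that] by (simp add: h_def)
  have stop: "h j x = 1" if "x \<in> M" "n x \<le> j" for j x
  proof -
    have "4 / \<epsilon> x \<le> real j" using that(2) by (simp add: n_def)
    then show ?thesis using pos[OF that(1)] by (simp add: h_def field_simps)
  qed
  have "(\<lambda>xs. as_pullback X (\<lambda>x. H (x, 1)) \<phi> xs - as_pullback X ((\<lambda>j x. H (x, h j x)) 0) \<phi> xs)
      \<in> as_coboundaries (Suc q) X"
  proof (rule contiguous_pullbacks_cohomologous)
    show "\<phi> \<in> as_cochains (Suc q) Y" using \<phi> by (simp add: as_cocycles_def)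
    show "H (x, h j x) \<in> topspace Y" if "x \<in> topspace X" for x j
      using continuous_map_image_subset_topspace[OF H] h01[of x j] that by (auto simp: X_eq)
    show "H (x, h j x) = H (x, 1)" if "x \<in> topspace X" "n x \<le> j" for x j
      using stop[of x j] that by (simp add: X_eq)
    fix x assume "x \<in> topspace X"
    then have x: "x \<in> M" by (simp add: X_eq)
    \<comment> \<open>After \<open>J\<close> steps the time is 1 wherever the Lebesgue number is at least \<open>\<epsilon> x / 2\<close>; up to then an
      error of \<open>\<rho>\<close> in the Lebesgue number changes the time by at most \<open>J * \<rho> / 4 = \<epsilon> x / 16\<close>.\<close>
    define J where "J = nat \<lceil>8 / \<epsilon> x\<rceil> + 1"
    define \<rho> where "\<rho> = \<epsilon> x / (4 * real J)"
    have e: "\<epsilon> x > 0" using pos x by blast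
    have "J \<ge> 1" by (simp add: J_def)
    have \<rho>: "\<rho> > 0" "\<rho> \<le> \<epsilon> x / 4" "real J * \<rho> = \<epsilon> x / 4"
      using e \<open>J \<ge> 1\<close> by (auto simp: \<rho>_def field_simps)
    have eps_near: "\<epsilon> x - \<rho> \<le> \<epsilon> y" "\<epsilon> y \<le> \<epsilon> x + \<rho>" "\<bar>\<epsilon> y - \<epsilon> x\<bar> \<le> \<rho>" if "y \<in> mball x \<rho>" for y
      using lip[of x y] lip[of y x] commute[of x y] that x by auto
    have h_near: "\<bar>h j y - h j x\<bar> \<le> \<epsilon> x / 16" if y: "y \<in> mball x \<rho>" for j y
    proof (cases "j \<le> J")
      case True
      have "\<bar>h j y - h j x\<bar> \<le> \<bar>real j * \<epsilon> y / 4 - real j * \<epsilon> x / 4\<bar>"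
        unfolding h_def by linarith
      also have "\<dots> = real j * \<bar>\<epsilon> y - \<epsilon> x\<bar> / 4"
        by (simp flip: diff_divide_distrib right_diff_distrib add: abs_mult)
      also have "\<dots> \<le> real J * \<rho> / 4"
        using True eps_near(3)[OF y] by (intro divide_right_mono mult_mono) auto
      finally show ?thesis using \<rho>(3) by simp
    next
      case False
      have "h j z = 1" if "\<epsilon> x / 2 \<le> \<epsilon> z" for z
      proof -
        have "8 / \<epsilon> x \<le> real j" using False by (simp add: J_def) linarith
        then have "8 \<le> real j * \<epsilon> x" using e by (simp add: field_simps)
        also have "\<dots> \<le> real j * (2 * \<epsilon> z)" using that by (intro mult_left_mono) auto
        finally show ?thesis by (simp add: h_def)
      qed
      from this[of x] this[of y] show ?thesis using e eps_near(1)[OF y] \<rho>(2) by simp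
    qed
    have step: "\<bar>h (Suc j) y - h j y\<bar> \<le> 5 * \<epsilon> x / 16" if y: "y \<in> mball x \<rho>" for j y
    proof -
      have "real (Suc j) * \<epsilon> y / 4 = real j * \<epsilon> y / 4 + \<epsilon> y / 4" by (simp add: field_simps)
      moreover have "\<epsilon> y > 0" using pos y by simp
      ultimately have "\<bar>h (Suc j) y - h j y\<bar> \<le> \<epsilon> y / 4" unfolding h_def by linarith
      then show ?thesis using eps_near(2)[OF y] \<rho>(2) by linarith
    qed
    have "\<exists>U\<in>\<U>. (\<lambda>x. H (x, h j x)) ` mball x \<rho> \<union> (\<lambda>x. H (x, h (Suc j) x)) ` mball x \<rho> \<subseteq> U" for j
    proof -
      obtain U where U: "U \<in> \<U>" "\<forall>y\<in>M. \<forall>s\<in>{0..1}. d x y < \<epsilon> x / 2 \<longrightarrow> \<bar>s - h j x\<bar> < \<epsilon> x / 2 \<longrightarrow> H (y, s) \<in> U"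
        using small[OF x _ h01[OF x], of "\<epsilon> x / 2" j] e by auto
      have "H (y, h j y) \<in> U \<and> H (y, h (Suc j) y) \<in> U" if y: "y \<in> mball x \<rho>" for y
      proof -
        have "y \<in> M" "d x y < \<epsilon> x / 2" using y \<rho>(2) e by auto
        moreover have "\<bar>h j y - h j x\<bar> < \<epsilon> x / 2" "\<bar>h (Suc j) y - h j x\<bar> < \<epsilon> x / 2"
          using h_near[OF y, of j] step[OF y, of j] e by linarith+
        ultimately show ?thesis using U(2) h01 by blast
      qed
      then show ?thesis using U(1) by blast
    qed
    then show "\<exists>V. openin X V \<and> x \<in> V \<and> (\<forall>j. \<exists>U. (\<forall>l. set l \<subseteq> U \<longrightarrow> as_delta (Suc q) Y \<phi> l = 0) \<and>
        (\<lambda>x. H (x, h j x)) ` V \<union> (\<lambda>x. H (x, h (Suc j) x)) ` V \<subseteq> U)"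
      using x \<rho>(1) unfolding X_eq \<U>_def by (intro exI[of _ "mball x \<rho>"]) blast
  qed
  then show ?thesis by (simp add: h_def)
qed

section \<open>Tautness of closed subsets\<close>

lemma as_coboundaries_diff:
  assumes "\<phi> \<in> as_coboundaries p X" "\<psi> \<in> as_coboundaries p X"
  shows "(\<lambda>xs. \<phi> xs - \<psi> xs) \<in> as_coboundaries p X"
  using as_coboundaries_add[OF assms(1) as_coboundaries_uminus[OF assms(2)]] by simp

text \<open>
A discontinuous map pulls back a coboundary as well if the identity \<open>\<phi> = \<delta>\<psi>\<close> holds on the images of
small simplices.
\<close>

lemma as_pullback_coboundary_if_locally_small:
  assumes im: "f ` topspace X \<subseteq> topspace Y"
    and \<phi>: "\<phi> \<in> as_cochains (Suc q) Y" and \<psi>: "\<psi> \<in> as_cochains q Y"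
    and small: "\<And>x. x \<in> topspace X \<Longrightarrow> \<exists>V. openin X V \<and> x \<in> V \<and>
      (\<forall>l. set l \<subseteq> f ` V \<longrightarrow> \<phi> l - as_delta q Y \<psi> l = 0)"
  shows "as_pullback X f \<phi> \<in> as_coboundaries (Suc q) X"
proof -
  have "(\<lambda>xs. as_pullback X f \<phi> xs - as_delta q X (as_pullback X f \<psi>) xs) \<in> as_locally_zero (Suc q) X"
  proof (rule as_locally_zeroI)
    show "(\<lambda>xs. as_pullback X f \<phi> xs - as_delta q X (as_pullback X f \<psi>) xs) \<in> as_cochains (Suc q) X"
      using as_delta_cochain[of q X "as_pullback X f \<psi>"]
      by (intro as_cochains_diff as_pullback_cochain[OF \<phi>]) simp
    fix x assume "x \<in> topspace X"
    from small[OF this] obtain V where V: "openin X V" "x \<in> V"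
      "\<And>l. set l \<subseteq> f ` V \<Longrightarrow> \<phi> l - as_delta q Y \<psi> l = 0" by blast
    have "as_pullback X f \<phi> xs - as_delta q X (as_pullback X f \<psi>) xs = 0" if "set xs \<subseteq> V" for xs
    proof -
      have "set (map f xs) \<subseteq> f ` V" using that by auto
      then have "\<phi> (map f xs) - as_delta q Y \<psi> (map f xs) = 0" by (rule V(3))
      then show ?thesis unfolding as_pullback_delta[OF im, symmetric] by (simp add: as_pullback_def)
    qed
    with V(1,2) show "\<exists>U. openin X U \<and> x \<in> U \<and> (\<forall>xs. set xs \<subseteq> U \<longrightarrow>
        as_pullback X f \<phi> xs - as_delta q X (as_pullback X f \<psi>) xs = 0)" by blast
  qed
  with as_pullback_cochain[OF \<phi>] as_pullback_cochain[OF \<psi>] show ?thesis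
    by (auto intro!: bexI[of _ "as_pullback X f \<psi>"])
qed

text \<open>
A point \<open>x\<close> near \<open>A\<close> is sent to some \<open>r x\<close> in \<open>A\<close> that is at most twice as
far away as any other point of \<open>A\<close>. This discontinuous retraction moves points near \<open>A\<close> only a
little, so it is contiguous to the identity, and it pulls a cobounding cochain on \<open>A\<close> back to a
neighbourhood.
\<close>

lemma as_coboundary_near_closed_subset:
  assumes X: "metrizable_space X" and A: "closedin X A"
    and \<phi>: "\<phi> \<in> as_cocycles (Suc q) X"
    and \<phi>_A: "as_pullback (subtopology X A) id \<phi> \<in> as_coboundaries (Suc q) (subtopology X A)"
  obtains N where "openin X N" "A \<subseteq> N"
    "as_pullback (subtopology X N) id \<phi> \<in> as_coboundaries (Suc q) (subtopology X N)"
proof -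
  obtain M d where Md: "Metric_space M d" and X_eq: "X = Metric_space.mtopology M d"
    using X unfolding metrizable_space_def by blast
  interpret Metric_space M d by fact
  have AM: "A \<subseteq> M" using closedin_subset[OF A] by (simp add: X_eq)
  then have topA: "topspace (subtopology X A) = A" by (auto simp: X_eq)
  let ?\<phi>A = "as_pullback (subtopology X A) id \<phi>"
  obtain \<psi> where \<psi>: "\<psi> \<in> as_cochains q (subtopology X A)"
    "(\<lambda>xs. ?\<phi>A xs - as_delta q (subtopology X A) \<psi> xs) \<in> as_locally_zero (Suc q) (subtopology X A)"
    using \<phi>_A by auto
  have \<phi>c: "\<phi> \<in> as_cochains (Suc q) X" using \<phi> by (simp add: as_cocycles_def)
  have "\<exists>e>0. (\<forall>l. set l \<subseteq> mball a (4 * e) \<longrightarrow> as_delta (Suc q) X \<phi> l = 0) \<and>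
      (\<forall>l. set l \<subseteq> mball a (4 * e) \<inter> A \<longrightarrow> ?\<phi>A l - as_delta q (subtopology X A) \<psi> l = 0)"
    if a: "a \<in> A" for a
  proof -
    have "a \<in> topspace X" "a \<in> topspace (subtopology X A)" using a AM by (auto simp: X_eq)
    obtain U where U: "openin X U" "a \<in> U" "\<And>l. set l \<subseteq> U \<Longrightarrow> as_delta (Suc q) X \<phi> l = 0"
      by (rule as_cocycle_small_simplices[OF \<phi> \<open>a \<in> topspace X\<close>]) (rule that)
    obtain W where W: "openin (subtopology X A) W" "a \<in> W"
      "\<And>l. set l \<subseteq> W \<Longrightarrow> ?\<phi>A l - as_delta q (subtopology X A) \<psi> l = 0"
      by (rule as_locally_zeroE[OF \<psi>(2) \<open>a \<in> topspace (subtopology X A)\<close>]) (rule that)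
    obtain T where T: "openin X T" "W = T \<inter> A" using W(1) by (auto simp: openin_subtopology)
    obtain r1 where r1: "r1 > 0" "mball a r1 \<subseteq> U" using U(1,2) unfolding X_eq openin_mtopology by meson
    obtain r2 where r2: "r2 > 0" "mball a r2 \<subseteq> T" using T W(2) unfolding X_eq openin_mtopology by blast
    let ?e = "min r1 r2 / 4"
    have "mball a (4 * ?e) \<subseteq> U" "mball a (4 * ?e) \<inter> A \<subseteq> W" using r1 r2 T by auto
    with U(3) W(3) r1(1) r2(1) show ?thesis by (intro exI[of _ ?e]) (meson order_trans min_less_iff_conj divide_pos_pos zero_less_numeral)
  qed
  \<comment> \<open>A point within \<open>e\<close> of \<open>a\<close> is moved by less than \<open>2 * e\<close>, so it stays within \<open>4 * e\<close> of \<open>a\<close>.\<close>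
  then obtain e where e: "\<And>a. a \<in> A \<Longrightarrow> e a > 0"
    "\<And>a l. a \<in> A \<Longrightarrow> set l \<subseteq> mball a (4 * e a) \<Longrightarrow> as_delta (Suc q) X \<phi> l = 0"
    "\<And>a l. a \<in> A \<Longrightarrow> set l \<subseteq> mball a (4 * e a) \<inter> A \<Longrightarrow> ?\<phi>A l - as_delta q (subtopology X A) \<psi> l = 0"
    by metis
  define N where "N = (\<Union>a\<in>A. mball a (e a))"
  have N: "openin X N" "A \<subseteq> N" "N \<subseteq> M"
    unfolding N_def using e(1) AM by (auto simp: X_eq)
  then have topN: "topspace (subtopology X N) = N" by (auto simp: X_eq)
  have "\<exists>b\<in>A. \<forall>c\<in>A. d x b \<le> 2 * d x c" if x: "x \<in> N" for x
  proof (cases "x \<in> A")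
    case True
    then show ?thesis using AM N(3) x by (intro bexI[of _ x]) auto
  next
    case False
    then have "x \<in> topspace X - A" using x N(3) by (auto simp: X_eq)
    moreover have "openin X (topspace X - A)" using A by (simp add: closedin_def)
    ultimately obtain \<rho> where \<rho>: "\<rho> > 0" "mball x \<rho> \<subseteq> topspace X - A"
      unfolding X_eq openin_mtopology by blast
    have far: "\<rho> \<le> d x c" if "c \<in> A" for c using \<rho>(2) that AM x N(3) by (force simp: X_eq)
    define D where "D = (INF c\<in>A. d x c)"
    have ne: "A \<noteq> {}" using x unfolding N_def by auto
    have "\<rho> \<le> D" unfolding D_def using ne far by (rule cINF_greatest)
    then have "D < 2 * D" using \<rho>(1) by simp
    moreover have bdd: "bdd_below (d x ` A)" by (rule bdd_belowI[of _ 0]) auto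
    ultimately obtain b where "b \<in> A" "d x b < 2 * D"
      using ne unfolding D_def by (auto simp: cINF_less_iff)
    moreover have "D \<le> d x c" if "c \<in> A" for c
      unfolding D_def using bdd that by (rule cINF_lower)
    ultimately show ?thesis by (meson less_imp_le mult_le_cancel_left_pos order_trans zero_less_numeral)
  qed
  then obtain r where r: "\<And>x. x \<in> N \<Longrightarrow> r x \<in> A" "\<And>x c. x \<in> N \<Longrightarrow> c \<in> A \<Longrightarrow> d x (r x) \<le> 2 * d x c"
    by metis
  have r_near: "r x \<in> mball a (4 * e a)" "x \<in> mball a (4 * e a)" if a: "a \<in> A" and x: "x \<in> mball a (e a)" for a x
  proof -
    have xN: "x \<in> N" using a x unfolding N_def by blast
    have M: "a \<in> M" "x \<in> M" "r x \<in> M" using a xN N(3) AM r(1) by auto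
    have "d a (r x) \<le> d a x + 2 * d x a" using r(2)[OF xN a] triangle[of a x "r x"] M by linarith
    then show "r x \<in> mball a (4 * e a)" using x M commute[of x a] e(1)[OF a] by auto
    show "x \<in> mball a (4 * e a)" using x e(1)[OF a] by auto
  qed
  let ?XN = "subtopology X N"
  have nbhd: "\<exists>a\<in>A. openin ?XN (mball a (e a)) \<and> x \<in> mball a (e a)" if x: "x \<in> N" for x
  proof -
    obtain a where a: "a \<in> A" "x \<in> mball a (e a)" using x unfolding N_def by blast
    have "mball a (e a) \<subseteq> N" using a(1) unfolding N_def by blast
    then have "openin ?XN (mball a (e a))"
      using N(1) by (simp add: openin_open_subtopology X_eq)
    with a show ?thesis by blast
  qed
  have "(\<lambda>xs. as_pullback ?XN r \<phi> xs - as_pullback ?XN ((\<lambda>j::nat. if j = 0 then id else r) 0) \<phi> xs) \<in> as_coboundaries (Suc q) ?XN"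
  proof (rule contiguous_pullbacks_cohomologous[where f = "\<lambda>j. if j = 0 then id else r" and n = "\<lambda>_. 1" and Y = X])
    show "\<phi> \<in> as_cochains (Suc q) X" by (rule \<phi>c)
    show "(if j = 0 then id else r) x \<in> topspace X" if "x \<in> topspace ?XN" for j :: nat and x
      using that r(1) AM by (auto simp: X_eq)
    show "(if j = 0 then id else r) x = r x" if "1 \<le> j" for j :: nat and x using that by simp
    fix x assume "x \<in> topspace ?XN"
    then obtain a where a: "a \<in> A" "openin ?XN (mball a (e a))" "x \<in> mball a (e a)"
      using nbhd topN by auto
    show "\<exists>V. openin ?XN V \<and> x \<in> V \<and> (\<forall>j::nat. \<exists>U. (\<forall>l. set l \<subseteq> U \<longrightarrow> as_delta (Suc q) X \<phi> l = 0) \<and>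
        (if j = 0 then id else r) ` V \<union> (if Suc j = 0 then id else r) ` V \<subseteq> U)"
    proof (rule exI[of _ "mball a (e a)"], intro conjI allI a(2,3))
      fix j :: nat
      have "(if j = 0 then id else r) ` mball a (e a) \<union> (if Suc j = 0 then id else r) ` mball a (e a)
          \<subseteq> mball a (4 * e a)"
        using r_near[OF a(1)] by (auto simp del: in_mball)
      then show "\<exists>U. (\<forall>l. set l \<subseteq> U \<longrightarrow> as_delta (Suc q) X \<phi> l = 0) \<and>
        (if j = 0 then id else r) ` mball a (e a) \<union> (if Suc j = 0 then id else r) ` mball a (e a) \<subseteq> U"
        using e(2)[OF a(1)] by blast
    qed
  qed
  then have 1: "(\<lambda>xs. as_pullback ?XN r \<phi> xs - as_pullback ?XN id \<phi> xs) \<in> as_coboundaries (Suc q) ?XN"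
    by simp
  have "as_pullback ?XN r ?\<phi>A \<in> as_coboundaries (Suc q) ?XN"
  proof (rule as_pullback_coboundary_if_locally_small[OF _ as_pullback_cochain[OF \<phi>c] \<psi>(1)])
    show rA: "r ` topspace ?XN \<subseteq> topspace (subtopology X A)" using r(1) topN topA by auto
    fix x assume "x \<in> topspace ?XN"
    then obtain a where a: "a \<in> A" "openin ?XN (mball a (e a))" "x \<in> mball a (e a)"
      using nbhd topN by auto
    have "r ` mball a (e a) \<subseteq> mball a (4 * e a) \<inter> A"
      using r_near(1)[OF a(1)] r(1) a(1) unfolding N_def by blast
    then show "\<exists>V. openin ?XN V \<and> x \<in> V \<and>
        (\<forall>l. set l \<subseteq> r ` V \<longrightarrow> ?\<phi>A l - as_delta q (subtopology X A) \<psi> l = 0)"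
      using a e(3)[OF a(1)] by (meson order_trans)
  qed
  moreover have "as_pullback ?XN r ?\<phi>A = as_pullback ?XN r \<phi>"
    using r(1) topN topA by (auto simp: as_pullback_def fun_eq_iff)
  ultimately have "as_pullback ?XN r \<phi> \<in> as_coboundaries (Suc q) ?XN" by simp
  from as_coboundaries_diff[OF this 1] have "as_pullback ?XN id \<phi> \<in> as_coboundaries (Suc q) ?XN" by simp
  with N(1,2) show thesis by (rule that)
qed

section \<open>Cup products and open covers\<close>

lemma as_class_eq_one_iff:
  fixes \<phi> :: "'a list \<Rightarrow> 'r::ab_group_add"
  shows "as_class p X \<phi> = as_coboundaries p X \<longleftrightarrow> \<phi> \<in> as_coboundaries p X"
proof -
  have "as_class p X (\<lambda>_. 0 :: 'r) = as_coboundaries p X" by (auto simp: as_class_iff)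
  then show ?thesis using as_class_eq_iff[of p X \<phi> "\<lambda>_. 0"] by (simp only: diff_zero)
qed

text \<open>
A cochain on \<open>U\<close> whose coboundary is \<open>\<phi>\<close> near each point of \<open>U\<close> extends by zero to all tuples, and
subtracting the coboundary of the extension makes \<open>\<phi>\<close> locally zero on \<open>U\<close>. This representative takes
the place of a relative cohomology class in the cup product argument.
\<close>

lemma cohomologous_cocycle_vanishing_on_open:
  assumes U: "openin X U" and \<phi>: "\<phi> \<in> as_cocycles (Suc q) X"
    and \<phi>_U: "as_pullback (subtopology X U) id \<phi> \<in> as_coboundaries (Suc q) (subtopology X U)"
  obtains \<phi>' where "\<phi>' \<in> as_cocycles (Suc q) X" "(\<lambda>xs. \<phi> xs - \<phi>' xs) \<in> as_coboundaries (Suc q) X"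
    "\<And>x. x \<in> U \<Longrightarrow> \<exists>W. openin X W \<and> x \<in> W \<and> (\<forall>xs. set xs \<subseteq> W \<longrightarrow> \<phi>' xs = 0)"
proof -
  have topU: "topspace (subtopology X U) = U" using openin_subset[OF U] by auto
  obtain \<psi> where \<psi>: "\<psi> \<in> as_cochains q (subtopology X U)"
    "(\<lambda>xs. as_pullback (subtopology X U) id \<phi> xs - as_delta q (subtopology X U) \<psi> xs)
      \<in> as_locally_zero (Suc q) (subtopology X U)"
    using \<phi>_U by auto
  have \<psi>X: "\<psi> \<in> as_cochains q X" using \<psi>(1) by (auto simp: as_cochains_def)
  have d: "as_delta q X \<psi> \<in> as_coboundaries (Suc q) X"
    using \<psi>X as_delta_cochain[of q X \<psi>] by (auto intro!: bexI[of _ \<psi>])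
  let ?\<phi>' = "\<lambda>xs. \<phi> xs - as_delta q X \<psi> xs"
  show thesis
  proof (rule that[of ?\<phi>'])
    have "as_delta q X \<psi> \<in> as_cocycles (Suc q) X" using d as_coboundaries_subset_cocycles by blast
    from as_cocycles_add[OF \<phi> as_cocycles_uminus[OF this]] show "?\<phi>' \<in> as_cocycles (Suc q) X" by simp
    show "(\<lambda>xs. \<phi> xs - ?\<phi>' xs) \<in> as_coboundaries (Suc q) X" using d by simp
    fix x assume x: "x \<in> U"
    then have "x \<in> topspace (subtopology X U)" using topU by simp
    obtain W where W: "openin (subtopology X U) W" "x \<in> W"
      "\<And>l. set l \<subseteq> W \<Longrightarrow> as_pullback (subtopology X U) id \<phi> l - as_delta q (subtopology X U) \<psi> l = 0"
      by (rule as_locally_zeroE[OF \<psi>(2) \<open>x \<in> topspace (subtopology X U)\<close>]) (rule that)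
    have WU: "openin X W" "W \<subseteq> U" using W(1) U by (auto simp: openin_open_subtopology)
    have "?\<phi>' xs = 0" if "set xs \<subseteq> W" for xs
    proof -
      have "set xs \<subseteq> U" "set xs \<subseteq> topspace X" using that WU(2) openin_subset[OF U] by auto
      then show ?thesis using W(3)[OF that] topU by (simp add: as_pullback_def as_delta_def)
    qed
    with WU W(2) show "\<exists>W. openin X W \<and> x \<in> W \<and> (\<forall>xs. set xs \<subseteq> W \<longrightarrow> ?\<phi>' xs = 0)" by blast
  qed
qed

text \<open>
Each point has a neighbourhood on which one of two suitable representatives vanishes, and there
the cup product of the representatives vanishes as well.
\<close>

lemma as_cup_coboundary_if_open_cover:
  assumes U: "openin X U" and V: "openin X V" and cover: "topspace X \<subseteq> U \<union> V"
    and \<phi>: "\<phi> \<in> as_cocycles (Suc p) X" and \<psi>: "\<psi> \<in> as_cocycles (Suc q) X"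
    and \<phi>_U: "as_pullback (subtopology X U) id \<phi> \<in> as_coboundaries (Suc p) (subtopology X U)"
    and \<psi>_V: "as_pullback (subtopology X V) id \<psi> \<in> as_coboundaries (Suc q) (subtopology X V)"
  shows "as_cochain_cup (Suc p) (Suc q) \<phi> \<psi> \<in> as_coboundaries (Suc p + Suc q) X"
proof -
  obtain \<phi>' where \<phi>': "\<phi>' \<in> as_cocycles (Suc p) X" "(\<lambda>xs. \<phi> xs - \<phi>' xs) \<in> as_coboundaries (Suc p) X"
    "\<And>x. x \<in> U \<Longrightarrow> \<exists>W. openin X W \<and> x \<in> W \<and> (\<forall>xs. set xs \<subseteq> W \<longrightarrow> \<phi>' xs = 0)"
    by (rule cohomologous_cocycle_vanishing_on_open[OF U \<phi> \<phi>_U]) (rule that)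
  obtain \<psi>' where \<psi>': "\<psi>' \<in> as_cocycles (Suc q) X" "(\<lambda>xs. \<psi> xs - \<psi>' xs) \<in> as_coboundaries (Suc q) X"
    "\<And>x. x \<in> V \<Longrightarrow> \<exists>W. openin X W \<and> x \<in> W \<and> (\<forall>xs. set xs \<subseteq> W \<longrightarrow> \<psi>' xs = 0)"
    by (rule cohomologous_cocycle_vanishing_on_open[OF V \<psi> \<psi>_V]) (rule that)
  let ?c = "as_cochain_cup (Suc p) (Suc q) \<phi>' \<psi>'"
  have "?c \<in> as_locally_zero (Suc p + Suc q) X"
  proof (rule as_locally_zeroI)
    show "?c \<in> as_cochains (Suc p + Suc q) X"
      using \<phi>'(1) \<psi>'(1) by (intro as_cochain_cup_cochain) (simp_all add: as_cocycles_def)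
    fix x assume "x \<in> topspace X"
    then obtain W where W: "openin X W" "x \<in> W"
      "(\<forall>xs. set xs \<subseteq> W \<longrightarrow> \<phi>' xs = 0) \<or> (\<forall>xs. set xs \<subseteq> W \<longrightarrow> \<psi>' xs = 0)"
      using cover \<phi>'(3) \<psi>'(3) by (metis UnE subsetD)
    have "?c xs = 0" if "set xs \<subseteq> W" for xs
    proof -
      have "set (take (Suc p + 1) xs) \<subseteq> W" "set (drop (Suc p) xs) \<subseteq> W"
        using that by (auto dest: in_set_takeD in_set_dropD)
      then have "\<phi>' (take (Suc p + 1) xs) = 0 \<or> \<psi>' (drop (Suc p) xs) = 0" using W(3) by blast
      then show ?thesis unfolding as_cochain_cup_def by auto
    qed
    with W(1,2) show "\<exists>U. openin X U \<and> x \<in> U \<and> (\<forall>xs. set xs \<subseteq> U \<longrightarrow> ?c xs = 0)" by blast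
  qed
  then have c: "?c \<in> as_coboundaries (Suc p + Suc q) X" using as_locally_zero_subset_coboundaries by blast
  have "as_class (Suc p + Suc q) X (as_cochain_cup (Suc p) (Suc q) \<phi> \<psi>) = as_class (Suc p + Suc q) X ?c"
    using as_cup_class[OF \<phi> \<psi>] as_cup_class[OF \<phi>'(1) \<psi>'(1)] \<phi>'(2) \<psi>'(2)
    by (simp add: as_class_eq_iff[THEN iffD2])
  then have "(\<lambda>xs. as_cochain_cup (Suc p) (Suc q) \<phi> \<psi> xs - ?c xs) \<in> as_coboundaries (Suc p + Suc q) X"
    by (simp only: as_class_eq_iff)
  from as_coboundaries_add[OF this c] show ?thesis by simp
qed

section \<open>Maps into powers and symmetric squares\<close>

lemma topspace_SP2: "topspace (SP2 X) = (\<lambda>(x, y). Upair x y) ` (topspace X \<times> topspace X)"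
proof (rule antisym)
  show "topspace (SP2 X) \<subseteq> (\<lambda>(x, y). Upair x y) ` (topspace X \<times> topspace X)"
    using openin_topspace[of "SP2 X"] unfolding openin_SP2 by (rule conjunct1)
  have "{p \<in> topspace X \<times> topspace X.
      (case p of (x, y) \<Rightarrow> Upair x y) \<in> (\<lambda>(x, y). Upair x y) ` (topspace X \<times> topspace X)}
    = topspace (prod_topology X X)" by auto
  then have "openin (SP2 X) ((\<lambda>(x, y). Upair x y) ` (topspace X \<times> topspace X))"
    unfolding openin_SP2 by (simp only: openin_topspace order_refl simp_thms)
  then show "(\<lambda>(x, y). Upair x y) ` (topspace X \<times> topspace X) \<subseteq> topspace (SP2 X)"
    by (rule openin_subset)
qed

lemma continuous_map_diag: "continuous_map Y (power_space m Y) (diag m)"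
  unfolding power_space_def continuous_map_componentwise by (auto simp: diag_def)

lemma metrizable_power_space: "metrizable_space X \<Longrightarrow> metrizable_space (power_space m X)"
  unfolding power_space_def metrizable_space_product_topology
  by (auto intro!: countable_finite finite_subset[of _ "{1..m}"])

lemma continuous_map_diagonal_pair: "continuous_map X (SP2 X) (\<lambda>x. Upair x x)"
  unfolding continuous_map
proof (intro conjI allI impI)
  show "(\<lambda>x. Upair x x) ` topspace X \<subseteq> topspace (SP2 X)" by (force simp: topspace_SP2)
  fix U assume U: "openin (SP2 X) U"
  have "continuous_map X (prod_topology X X) (\<lambda>x. (x, x))" by (intro continuous_map_pairedI) auto
  from openin_continuous_map_preimage[OF this U[unfolded openin_SP2, THEN conjunct2]]
  show "openin X {x \<in> topspace X. Upair x x \<in> U}"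
    by (rule back_subst[where P = "openin X"]) auto
qed

lemma continuous_map_sq_diag: "continuous_map (power_space m X) (power_space m (SP2 X)) (sq_diag m)"
  unfolding power_space_def continuous_map_componentwise
proof (intro conjI ballI)
  fix i assume i: "i \<in> {1..m}"
  have "continuous_map (product_topology (\<lambda>_. X) {1..m}) (SP2 X) ((\<lambda>x. Upair x x) \<circ> (\<lambda>x. x i))"
    using i by (intro continuous_map_compose[OF _ continuous_map_diagonal_pair] continuous_map_product_projection)
  then show "continuous_map (product_topology (\<lambda>_. X) {1..m}) (SP2 X) (\<lambda>x. sq_diag m x i)"
    using i by (simp add: sq_diag_def o_def)
qed (auto simp: sq_diag_def)

text \<open>
Scaling the times \<open>\<tau> i\<close> down to 0 is a homotopy from the given map to one with equal coordinates,
which factors through the diagonal.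
\<close>

lemma homotopic_to_diagonal_pullback_coboundary:
  fixes K :: "'a \<times> real \<Rightarrow> 'b" and \<phi> :: "(nat \<Rightarrow> 'b) list \<Rightarrow> 'r::ab_group_add"
  assumes X: "metrizable_space X"
    and K: "continuous_map (prod_topology X (top_of_set {0..1})) Y K"
    and \<tau>: "\<And>i. i \<in> {1..m} \<Longrightarrow> \<tau> i \<in> {0..1}"
    and \<phi>: "\<phi> \<in> as_cocycles (Suc q) (power_space m Y)"
    and diag: "as_pullback Y (diag m) \<phi> \<in> as_coboundaries (Suc q) Y"
  shows "as_pullback X (\<lambda>x. \<lambda>i\<in>{1..m}. K (x, \<tau> i)) \<phi> \<in> as_coboundaries (Suc q) X"
proof -
  define H where "H = (\<lambda>(x, u). \<lambda>i\<in>{1..m}. K (x, u * \<tau> i))"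
  let ?XI = "prod_topology X (top_of_set {0..1::real})"
  have "continuous_map ?XI (power_space m Y) H"
    unfolding power_space_def continuous_map_componentwise
  proof (intro conjI ballI)
    show "H ` topspace ?XI \<subseteq> extensional {1..m}" by (auto simp: H_def)
    fix i assume i: "i \<in> {1..m}"
    have "continuous_map ?XI euclideanreal (\<lambda>z. snd z * \<tau> i)"
      by (intro continuous_map_real_mult continuous_map_into_fulltopology[OF continuous_map_snd] continuous_map_const[THEN iffD2]) simp
    moreover have "snd z * \<tau> i \<in> {0..1}" if "z \<in> topspace ?XI" for z
      using that \<tau>[OF i] by (auto intro: mult_le_one)
    ultimately have "continuous_map ?XI ?XI (\<lambda>z. (fst z, snd z * \<tau> i))"
      by (intro continuous_map_pairedI continuous_map_fst) (auto simp: continuous_map_in_subtopology)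
    from continuous_map_compose[OF this K] show "continuous_map ?XI Y (\<lambda>z. H z i)"
      using i by (simp add: H_def o_def case_prod_beta)
  qed
  from homotopic_pullbacks_cohomologous[OF X this \<phi>]
  have 1: "(\<lambda>xs. as_pullback X (\<lambda>x. H (x, 1)) \<phi> xs - as_pullback X (\<lambda>x. H (x, 0)) \<phi> xs) \<in> as_coboundaries (Suc q) X" .
  have "continuous_map X ?XI (\<lambda>x. (x, 0))"
    by (intro continuous_map_pairedI) auto
  from continuous_map_compose[OF this K] have g: "continuous_map X Y (\<lambda>x. K (x, 0))" by (simp add: o_def)
  \<comment> \<open>At parameter 0 all coordinates are \<open>K (x, 0)\<close>.\<close>
  have "as_pullback X (\<lambda>x. K (x, 0)) (as_pullback Y (diag m) \<phi>) = as_pullback X (\<lambda>x. H (x, 0)) \<phi>"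
    using continuous_map_image_subset_topspace[OF g]
    by (auto simp: as_pullback_def fun_eq_iff H_def diag_def o_def)
  with as_pullback_coboundary[OF g diag]
  have "as_pullback X (\<lambda>x. H (x, 0)) \<phi> \<in> as_coboundaries (Suc q) X" by simp
  from as_coboundaries_add[OF 1 this] show ?thesis by (simp add: H_def)
qed

section \<open>Supports of measures with at most two atoms\<close>

lemma Bn_neighbourhood_LP_close:
  assumes "p \<in> topspace (Bn N)" "0 < e"
  obtains U where "openin (Bn N) U" "p \<in> U" "\<And>q. q \<in> U \<Longrightarrow> LP_close p q e"
proof -
  interpret Metric_space "{p. finite (set_pmf p) \<and> card (set_pmf p) \<le> N}" levy_prokhorov
    by (rule Metric_space_levy_prokhorov)
  show thesis
    by (rule that[of "mball p e"]) (use assms in \<open>auto simp: Bn_def intro: LP_close_if_levy_prokhorov_less\<close>)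
qed

lemma LP_close_commute: "LP_close p q e \<longleftrightarrow> LP_close q p e"
  unfolding LP_close_def by blast

lemma LP_close_pmf_le:
  assumes "LP_close p q e"
  shows "pmf p a - e \<le> measure_pmf.prob q (ball a e)"
proof -
  have "{a} \<in> sets borel" by simp
  with assms have "measure_pmf.prob p {a} \<le> measure_pmf.prob q (\<Union>a\<in>{a}. ball a e) + e"
    unfolding LP_close_def by blast
  then show ?thesis by (simp add: measure_pmf_single)
qed

text \<open>
An atom heavier than \<open>e\<close> cannot get lost, whereas a lighter one can.
\<close>

lemma LP_close_nearby_atom:
  assumes "LP_close p q e" "e < pmf p a"
  obtains b where "b \<in> set_pmf q" "dist a b < e"
proof -
  have "measure_pmf.prob q (ball a e) > 0" using LP_close_pmf_le[OF assms(1), of a] assms(2) by linarith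
  then have "ball a e \<inter> set_pmf q \<noteq> {}" using measure_Int_set_pmf[of q "ball a e"] by force
  then show thesis using that by auto
qed

text \<open>
The set of atoms as a point of the symmetric square, so that a single atom is counted twice. The
value is arbitrary for more than two atoms.
\<close>

definition support_pair :: "'a pmf \<Rightarrow> 'a uprod" where
  "support_pair p = (SOME z. set_uprod z = set_pmf p)"

lemma set_uprod_eq_doubleton: "set_uprod z = {a, b} \<longleftrightarrow> z = Upair a b"
  by (cases z) (auto simp: doubleton_eq_iff Upair_inject)

lemma set_pmf_at_most_two_atoms:
  assumes "p \<in> topspace (Bn N)" "N \<le> 2"
  obtains a b where "set_pmf p = {a, b}" "support_pair p = Upair a b"
proof -
  have "finite (set_pmf p)" "card (set_pmf p) \<le> 2" using assms by auto
  moreover have "card (set_pmf p) \<noteq> 0" using calculation(1) set_pmf_not_empty[of p] by simp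
  ultimately have "card (set_pmf p) = 1 \<or> card (set_pmf p) = 2" by linarith
  then obtain a b where ab: "set_pmf p = {a, b}"
    by (auto simp: card_1_singleton_iff card_2_iff)
  then have "support_pair p = Upair a b"
    unfolding support_pair_def by (simp add: set_uprod_eq_doubleton)
  with ab show thesis by (rule that)
qed

lemma support_pair_return: "support_pair (return_pmf a) = Upair a a"
  unfolding support_pair_def using set_uprod_eq_doubleton[of _ a a] by simp

text \<open>
If no atom is lighter than \<open>c\<close>, then measures at distance less than \<open>c\<close> have supports at small
Hausdorff distance, and close sets with at most two points are close as unordered pairs. Without
the bound an atom could disappear in the limit.
\<close>

lemma continuous_map_support_pair:
  fixes c :: real
  assumes N: "N \<le> 2" and c: "0 < c"
  shows "continuous_map (subtopology (Bn N) {p. \<forall>a\<in>set_pmf p. c \<le> pmf p a})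
    (SP2 (euclidean :: 'a::metric_space topology)) support_pair"
    (is "continuous_map ?B _ _")
  unfolding continuous_map
proof (intro conjI allI impI)
  have top: "topspace (SP2 (euclidean :: 'a topology)) = UNIV"
    unfolding topspace_SP2 by (auto simp: image_iff) (metis uprod_exhaust)
  show "support_pair ` topspace ?B \<subseteq> topspace (SP2 (euclidean :: 'a topology))" by (simp add: top)
  fix U :: "'a uprod set" assume U: "openin (SP2 euclidean) U"
  show "openin ?B {p \<in> topspace ?B. support_pair p \<in> U}"
  proof (subst openin_subopen, intro ballI)
    fix p :: "'a pmf" assume "p \<in> {p \<in> topspace ?B. support_pair p \<in> U}"
    then have p: "p \<in> topspace (Bn N)" "\<And>a. a \<in> set_pmf p \<Longrightarrow> c \<le> pmf p a" "support_pair p \<in> U" by auto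
    obtain a b where ab: "set_pmf p = {a, b}" "support_pair p = Upair a b"
      by (rule set_pmf_at_most_two_atoms[OF p(1) N]) (rule that)
    have "openin (prod_topology euclidean euclidean) {(x, y). Upair x y \<in> U}"
      using U unfolding openin_SP2 by (simp add: case_prod_unfold)
    moreover have "(a, b) \<in> {(x, y). Upair x y \<in> U}" using p(3) ab(2) by simp
    ultimately obtain A B where AB: "open A" "open B" "a \<in> A" "b \<in> B" "A \<times> B \<subseteq> {(x, y). Upair x y \<in> U}"
      unfolding openin_prod_topology_alt open_openin[symmetric] by meson
    obtain r1 where r1: "r1 > 0" "ball a r1 \<subseteq> A" using AB(1,3) by (meson openE)
    obtain r2 where r2: "r2 > 0" "ball b r2 \<subseteq> B" using AB(2,4) by (meson openE)
    \<comment> \<open>The last bound makes the balls around two distinct atoms disjoint, so that no atom of a nearby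
      measure is close to both of them.\<close>
    define e where "e = min (min r1 r2) (min (c / 2) (if a = b then 1 else dist a b / 2))"
    have e: "0 < e" "e \<le> r1" "e \<le> r2" "e < c" "a \<noteq> b \<Longrightarrow> 2 * e \<le> dist a b"
      unfolding e_def using r1 r2 c by (auto simp: min_def)
    obtain V where V: "openin (Bn N) V" "p \<in> V" "\<And>q. q \<in> V \<Longrightarrow> LP_close p q e"
      by (rule Bn_neighbourhood_LP_close[OF p(1) e(1)]) (rule that)
    have "support_pair q \<in> U" if q: "q \<in> V" "\<And>x. x \<in> set_pmf q \<Longrightarrow> c \<le> pmf q x" for q
    proof -
      have pq: "LP_close p q e" and qp: "LP_close q p e" using V(3)[OF q(1)] LP_close_commute by auto
      have "q \<in> topspace (Bn N)" using openin_subset[OF V(1)] q(1) by blast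
      then obtain a' b' where ab': "set_pmf q = {a', b'}" "support_pair q = Upair a' b'"
        by (rule set_pmf_at_most_two_atoms[OF _ N]) (rule that)
      have near_q: "\<exists>y\<in>{a', b'}. dist x y < e" if "x \<in> {a, b}" for x
        using LP_close_nearby_atom[OF pq, of x] p(2)[of x] e(4) that ab(1) ab'(1) by fastforce
      have near_p: "\<exists>y\<in>{a, b}. dist x y < e" if "x \<in> {a', b'}" for x
        using LP_close_nearby_atom[OF qp, of x] q(2)[of x] e(4) that ab(1) ab'(1) by fastforce
      have not_both: "a = b" if "dist a x < e" "dist b x < e" for x
        using that e(5) dist_triangle2[of a b x] by fastforce
      consider "dist a a' < e" "dist b b' < e" | "dist a b' < e" "dist b a' < e"
        using near_q[of a] near_q[of b] near_p[of a'] near_p[of b'] not_both[of a'] not_both[of b']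
        by (auto simp: dist_commute)
      then have "(a', b') \<in> A \<times> B \<or> (b', a') \<in> A \<times> B"
        using r1(2) r2(2) e(2,3) by cases (auto simp: subset_iff)
      then have "Upair a' b' \<in> U \<or> Upair b' a' \<in> U" using AB(5) by blast
      moreover have "Upair b' a' = Upair a' b'" by simp
      ultimately show ?thesis unfolding ab'(2) by metis
    qed
    then have "V \<inter> {p. \<forall>a\<in>set_pmf p. c \<le> pmf p a} \<subseteq> {p \<in> topspace ?B. support_pair p \<in> U}"
      using openin_subset[OF V(1)] by auto
    moreover have "openin ?B (V \<inter> {p. \<forall>a\<in>set_pmf p. c \<le> pmf p a})"
      using V(1) by (rule openin_subtopology_Int)
    moreover have "p \<in> V \<inter> {p. \<forall>a\<in>set_pmf p. c \<le> pmf p a}" using V(2) p(2) by simp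
    ultimately show "\<exists>T. openin ?B T \<and> p \<in> T \<and> T \<subseteq> {p \<in> topspace ?B. support_pair p \<in> U}" by blast
  qed
qed

text \<open>
Mass close to two distinct atoms must be carried by two distinct atoms again; as there are no
others, each of them carries nearly the weight of the old one.
\<close>

lemma openin_two_atoms_heavier_than:
  fixes c :: real
  assumes N: "N \<le> 2" and c: "0 \<le> c"
  shows "openin (Bn N) {p \<in> topspace (Bn N). card (set_pmf p) = 2 \<and> (\<forall>a\<in>set_pmf p. c < pmf p a)}"
    (is "openin _ ?T")
proof (subst openin_subopen, intro ballI)
  fix p :: "'a pmf" assume "p \<in> ?T"
  then have p: "p \<in> topspace (Bn N)" "card (set_pmf p) = 2" "\<And>a. a \<in> set_pmf p \<Longrightarrow> c < pmf p a" by auto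
  obtain a b where ab: "set_pmf p = {a, b}" "a \<noteq> b" using p(2) by (auto simp: card_2_iff)
  define e where "e = min (dist a b / 2) (min (pmf p a - c) (pmf p b - c) / 2)"
  have "c < pmf p a" "c < pmf p b" using p(3) ab(1) by auto
  then have e: "0 < e" "2 * e \<le> dist a b" "e < pmf p a - c" "e < pmf p b - c"
    unfolding e_def using ab(2) by (auto simp: min_def)
  obtain V where V: "openin (Bn N) V" "p \<in> V" "\<And>q. q \<in> V \<Longrightarrow> LP_close p q e"
    by (rule Bn_neighbourhood_LP_close[OF p(1) e(1)]) (rule that)
  have "q \<in> ?T" if q: "q \<in> V" for q
  proof -
    have qB: "q \<in> topspace (Bn N)" using openin_subset[OF V(1)] q by blast
    have heavy: "c < measure_pmf.prob q (ball a e)" "c < measure_pmf.prob q (ball b e)"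
      using LP_close_pmf_le[OF V(3)[OF q], of a] LP_close_pmf_le[OF V(3)[OF q], of b] e(3,4) by linarith+
    obtain a' b' where ab': "a' \<in> set_pmf q" "dist a a' < e" "b' \<in> set_pmf q" "dist b b' < e"
      using LP_close_nearby_atom[OF V(3)[OF q], of a] LP_close_nearby_atom[OF V(3)[OF q], of b] e(3,4) c
      by (metis add_increasing2 less_diff_eq less_le_trans linorder_not_le nle_le)
    have far: "\<not> (dist a x < e \<and> dist b x < e)" for x
      using e(2) dist_triangle2[of a b x] by linarith
    then have "a' \<noteq> b'" using ab' by blast
    have fin: "finite (set_pmf q)" "card (set_pmf q) \<le> 2" using qB N by auto
    have "set_pmf q = {a', b'}"
      by (rule sym, rule card_seteq[OF fin(1)]) (use ab' fin(2) \<open>a' \<noteq> b'\<close> in auto)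
    moreover have "ball a e \<inter> {a', b'} = {a'}" "ball b e \<inter> {a', b'} = {b'}" using ab' far by auto
    ultimately have "c < pmf q a'" "c < pmf q b'"
      using heavy measure_Int_set_pmf[of q "ball a e"] measure_Int_set_pmf[of q "ball b e"]
      by (simp_all add: measure_pmf_single)
    with \<open>set_pmf q = {a', b'}\<close> \<open>a' \<noteq> b'\<close> qB show ?thesis by simp
  qed
  with V show "\<exists>T. openin (Bn N) T \<and> p \<in> T \<and> T \<subseteq> ?T" by blast
qed

text \<open>
This is where resolvability enters. If the path has two atoms at time \<open>t\<close>, then the resolving
measure consists of exactly two paths in \<open>X\<close>, which carry the weights seen at time \<open>t\<close>. At any other
time an atom carries at least one of these weights.
\<close>

lemma resolvable_path_weights:
  assumes f: "f \<in> topspace (RP N)" and N: "N \<le> 2" and t: "t \<in> {0..1}" "u \<in> {0..1}"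
    and two: "card (set_pmf (f t)) = 2" and heavy: "\<And>a. a \<in> set_pmf (f t) \<Longrightarrow> c < pmf (f t) a"
    and a: "a \<in> set_pmf (f u)"
  shows "c < pmf (f u) a"
proof -
  obtain \<mu> where \<mu>: "f = Phi \<mu>" "finite (set_pmf \<mu>)" "card (set_pmf \<mu>) \<le> N"
    using f unfolding RP_def by auto
  have f_eq: "f v = map_pmf (\<lambda>\<alpha>. \<alpha> v) \<mu>" if "v \<in> {0..1}" for v using that \<mu>(1) by (simp add: Phi_def)
  have "card ((\<lambda>\<alpha>. \<alpha> t) ` set_pmf \<mu>) = 2" using two t(1) by (simp add: f_eq)
  then have "card ((\<lambda>\<alpha>. \<alpha> t) ` set_pmf \<mu>) = card (set_pmf \<mu>)"
    using card_image_le[OF \<mu>(2), of "\<lambda>\<alpha>. \<alpha> t"] \<mu>(3) N by linarith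
  then have inj: "inj_on (\<lambda>\<alpha>. \<alpha> t) (set_pmf \<mu>)" by (rule eq_card_imp_inj_on[OF \<mu>(2)])
  obtain \<alpha> where \<alpha>: "\<alpha> \<in> set_pmf \<mu>" "a = \<alpha> u" using a t(2) by (auto simp: f_eq)
  have "pmf \<mu> \<alpha> = pmf (f t) (\<alpha> t)" using pmf_map_inj[OF inj \<alpha>(1)] t(1) by (simp add: f_eq)
  then have "c < pmf \<mu> \<alpha>" using heavy[of "\<alpha> t"] \<alpha>(1) t(1) by (simp add: f_eq)
  also have "pmf \<mu> \<alpha> \<le> pmf (f u) a"
    unfolding f_eq[OF t(2)] pmf_map using \<alpha>(2)
    by (auto simp flip: measure_pmf_single intro!: measure_pmf.finite_measure_mono)
  finally show ?thesis .
qed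

section \<open>Resolvable motion planners\<close>

lemma continuous_map_path_evaluation:
  "continuous_map (prod_topology (path_space Z) (top_of_set {0..1})) Z (\<lambda>(f, t). f t)"
  unfolding continuous_map
proof (intro conjI allI impI)
  let ?P = "prod_topology (path_space Z) (top_of_set {0..1::real})"
  show "(\<lambda>(f, t). f t) ` topspace ?P \<subseteq> topspace Z"
    by (force simp: pathin_def dest: continuous_map_image_subset_topspace)
  fix U assume U: "openin Z U"
  show "openin ?P {z \<in> topspace ?P. (case z of (f, t) \<Rightarrow> f t) \<in> U}"
    unfolding openin_prod_topology_alt
  proof (intro allI impI)
    fix f :: "real \<Rightarrow> 'a" and t :: real
    assume "(f, t) \<in> {z \<in> topspace ?P. (case z of (f, t) \<Rightarrow> f t) \<in> U}"
    then have f: "f \<in> extensional {0..1}" "pathin Z f" and t: "t \<in> {0..1}" and ft: "f t \<in> U" by auto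
    have "openin (top_of_set {0..1}) {s \<in> {0..1}. f s \<in> U}"
      using openin_continuous_map_preimage[OF f(2)[unfolded pathin_def] U] by simp
    then obtain r where r: "r > 0" "ball t r \<inter> {0..1} \<subseteq> {s \<in> {0..1}. f s \<in> U}"
      using t ft unfolding openin_contains_ball by blast
    let ?K = "cball t (r / 2) \<inter> {0..1}"
    let ?V = "{g \<in> extensional {0..1}. pathin Z g \<and> g ` ?K \<subseteq> U}"
    let ?W = "ball t (r / 2) \<inter> {0..1}"
    have "openin (path_space Z) ?V" unfolding path_space_def
      by (rule topology_generated_by_Basis) (use U in \<open>auto intro!: exI[of _ ?K] exI[of _ U]\<close>)
    moreover have "openin (top_of_set {0..1}) ?W" by (simp add: openin_open_Int Int_commute)
    moreover have "f \<in> ?V" using f r by force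
    moreover have "t \<in> ?W" using r(1) t by simp
    moreover have "?V \<times> ?W \<subseteq> {z \<in> topspace ?P. (case z of (f, t) \<Rightarrow> f t) \<in> U}" by force
    ultimately show "\<exists>V W. openin (path_space Z) V \<and> openin (top_of_set {0..1}) W \<and> f \<in> V \<and> t \<in> W \<and>
        V \<times> W \<subseteq> {z \<in> topspace ?P. (case z of (f, t) \<Rightarrow> f t) \<in> U}" by blast
  qed
qed

text \<open>
Evaluation of paths is jointly continuous, so continuity of the support is only a matter of the
weights, and it suffices to bound them locally in \<open>z\<close> and uniformly in time.
\<close>

lemma continuous_map_support_pair_of_resolvable:
  fixes s :: "'z \<Rightarrow> real \<Rightarrow> 'a::metric_space pmf"
  assumes s: "continuous_map Z (RP N) s" and N: "N \<le> 2"
    and bound: "\<And>z. z \<in> topspace Z \<Longrightarrow> \<exists>V c. openin Z V \<and> z \<in> V \<and> 0 < (c::real) \<and>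
      (\<forall>y\<in>V. \<forall>t\<in>{0..1}. \<forall>a\<in>set_pmf (s y t). c \<le> pmf (s y t) a)"
  shows "continuous_map (prod_topology Z (top_of_set {0..1})) (SP2 euclidean) (\<lambda>(z, t). support_pair (s z t))"
proof -
  let ?I = "top_of_set {0..1::real}"
  have "continuous_map Z (path_space (Bn N)) s"
    using s unfolding RP_def by (rule continuous_map_into_fulltopology)
  from continuous_map_compose[OF continuous_map_fst this]
  have "continuous_map (prod_topology Z ?I) (prod_topology (path_space (Bn N)) ?I) (\<lambda>w. (s (fst w), snd w))"
    by (intro continuous_map_pairedI continuous_map_snd) (simp add: o_def)
  from continuous_map_compose[OF this continuous_map_path_evaluation]
  have eval: "continuous_map (prod_topology Z ?I) (Bn N) (\<lambda>w. s (fst w) (snd w))" by (simp add: o_def)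
  obtain V c where V: "\<And>z. z \<in> topspace Z \<Longrightarrow> openin Z (V z)" "\<And>z. z \<in> topspace Z \<Longrightarrow> z \<in> V z"
    and c: "\<And>z. z \<in> topspace Z \<Longrightarrow> 0 < (c z :: real)"
    and Vc: "\<And>z y t a. z \<in> topspace Z \<Longrightarrow> y \<in> V z \<Longrightarrow> t \<in> {0..1} \<Longrightarrow> a \<in> set_pmf (s y t) \<Longrightarrow> c z \<le> pmf (s y t) a"
    using bound by metis
  show ?thesis
  proof (rule pasting_lemma[where I = "topspace Z" and T = "\<lambda>z. V z \<times> {0..1}" and f = "\<lambda>_ (z, t). support_pair (s z t)"])
    show "openin (prod_topology Z ?I) (V z \<times> {0..1})" if "z \<in> topspace Z" for z
      using V(1)[OF that] by (simp add: openin_prod_Times_iff)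
    show "\<exists>j. j \<in> topspace Z \<and> w \<in> V j \<times> {0..1} \<and> (case w of (z, t) \<Rightarrow> support_pair (s z t)) = (case w of (z, t) \<Rightarrow> support_pair (s z t))"
      if "w \<in> topspace (prod_topology Z ?I)" for w
      using that V(2) by (intro exI[of _ "fst w"]) auto
    fix z assume z: "z \<in> topspace Z"
    let ?W = "subtopology (prod_topology Z ?I) (V z \<times> {0..1})"
    have "continuous_map ?W (subtopology (Bn N) {p. \<forall>a\<in>set_pmf p. c z \<le> pmf p a}) (\<lambda>w. s (fst w) (snd w))"
      unfolding continuous_map_in_subtopology
      using continuous_map_from_subtopology[OF eval] Vc[OF z] by auto
    from continuous_map_compose[OF this continuous_map_support_pair[OF N c[OF z]]]
    show "continuous_map ?W (SP2 euclidean) (\<lambda>(z, t). support_pair (s z t))"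
      by (simp add: o_def case_prod_unfold)
  qed simp
qed

text \<open>
Over \<open>S\<close> the support pairs form continuous paths in the symmetric square. At the prescribed times
they are the coordinates of \<open>sq_diag\<close>, which is therefore homotopic to a map into the diagonal.
\<close>

lemma sq_diag_pullback_coboundary:
  fixes s :: "(nat \<Rightarrow> 'a::metric_space) \<Rightarrow> real \<Rightarrow> 'a pmf"
    and \<phi> :: "(nat \<Rightarrow> 'a uprod) list \<Rightarrow> 'r::ab_group_add"
  assumes m: "m \<ge> 2"
    and s: "continuous_map (power_space m euclidean) (RP N) s" and N: "N \<le> 2"
    and ends: "\<And>x i. x \<in> topspace (power_space m euclidean) \<Longrightarrow> i \<in> {1..m} \<Longrightarrow>
      s x ((real i - 1) / (real m - 1)) = return_pmf (x i)"
    and bound: "\<And>x. x \<in> topspace (subtopology (power_space m euclidean) S) \<Longrightarrow>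
      \<exists>V c. openin (subtopology (power_space m euclidean) S) V \<and> x \<in> V \<and> 0 < (c::real) \<and>
        (\<forall>y\<in>V. \<forall>t\<in>{0..1}. \<forall>a\<in>set_pmf (s y t). c \<le> pmf (s y t) a)"
    and \<phi>: "\<phi> \<in> as_cocycles (Suc q) (power_space m (SP2 euclidean))"
    and diag: "as_pullback (SP2 euclidean) (diag m) \<phi> \<in> as_coboundaries (Suc q) (SP2 euclidean)"
  shows "as_pullback (subtopology (power_space m euclidean) S) id (as_pullback (power_space m euclidean) (sq_diag m) \<phi>)
    \<in> as_coboundaries (Suc q) (subtopology (power_space m euclidean) S)"
proof -
  let ?Z = "subtopology (power_space m (euclidean :: 'a topology)) S"
  let ?\<tau> = "\<lambda>i::nat. (real i - 1) / (real m - 1)"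
  have "as_pullback ?Z (\<lambda>x. \<lambda>i\<in>{1..m}. case (x, ?\<tau> i) of (z, t) \<Rightarrow> support_pair (s z t)) \<phi> \<in> as_coboundaries (Suc q) ?Z"
  proof (rule homotopic_to_diagonal_pullback_coboundary[OF _ _ _ \<phi> diag])
    show "metrizable_space ?Z"
      by (intro metrizable_space_subtopology metrizable_power_space metrizable_space_euclidean)
    show "continuous_map (prod_topology ?Z (top_of_set {0..1})) (SP2 euclidean) (\<lambda>(z, t). support_pair (s z t))"
      using continuous_map_from_subtopology[OF s] N bound by (rule continuous_map_support_pair_of_resolvable)
    show "?\<tau> i \<in> {0..1}" if "i \<in> {1..m}" for i using that m by (auto simp: divide_le_eq_1)
  qed
  moreover have "(\<lambda>i\<in>{1..m}. support_pair (s x (?\<tau> i))) = sq_diag m x" if "x \<in> topspace ?Z" for x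
    using that ends by (auto simp: sq_diag_def support_pair_return)
  then have "as_pullback ?Z (\<lambda>x. \<lambda>i\<in>{1..m}. case (x, ?\<tau> i) of (z, t) \<Rightarrow> support_pair (s z t)) \<phi>
      = as_pullback ?Z id (as_pullback (power_space m euclidean) (sq_diag m) \<phi>)"
    by (auto simp: as_pullback_def fun_eq_iff subset_iff intro!: arg_cong[where f = \<phi>])
  ultimately show ?thesis by simp
qed

text \<open>
The space is covered by the open set \<open>C\<close> of the points whose path splits into two atoms at some
time and the closed set \<open>A\<close> of the points whose path consists of Dirac measures. The weights are
bounded below on both, locally on \<open>C\<close> and by 1 on \<open>A\<close>, so both pullbacks vanish on both sets. The
first one is used on a neighbourhood of \<open>A\<close>, the second one on \<open>C\<close>.
\<close>

lemma cup_coboundary_if_resolvable_motion_planner: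
  fixes s :: "(nat \<Rightarrow> 'a::metric_space) \<Rightarrow> real \<Rightarrow> 'a pmf"
    and \<phi> \<psi> :: "(nat \<Rightarrow> 'a uprod) list \<Rightarrow> 'r::ring"
  assumes m: "m \<ge> 2"
    and s: "continuous_map (power_space m euclidean) (RP N) s" and N: "N \<le> 2"
    and ends: "\<And>x i. x \<in> topspace (power_space m euclidean) \<Longrightarrow> i \<in> {1..m} \<Longrightarrow>
      s x ((real i - 1) / (real m - 1)) = return_pmf (x i)"
    and \<phi>: "\<phi> \<in> as_cocycles (Suc p) (power_space m (SP2 euclidean))"
      "as_pullback (SP2 euclidean) (diag m) \<phi> \<in> as_coboundaries (Suc p) (SP2 euclidean)"
    and \<psi>: "\<psi> \<in> as_cocycles (Suc q) (power_space m (SP2 euclidean))"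
      "as_pullback (SP2 euclidean) (diag m) \<psi> \<in> as_coboundaries (Suc q) (SP2 euclidean)"
  shows "as_cochain_cup (Suc p) (Suc q) (as_pullback (power_space m euclidean) (sq_diag m) \<phi>)
      (as_pullback (power_space m euclidean) (sq_diag m) \<psi>)
    \<in> as_coboundaries (Suc p + Suc q) (power_space m (euclidean :: 'a topology))"
proof -
  let ?P = "power_space m (euclidean :: 'a topology)"
  define heavy where "heavy c = {p \<in> topspace (Bn N :: 'a pmf topology). card (set_pmf p) = 2 \<and> (\<forall>a\<in>set_pmf p. c < pmf p a)}"
    for c :: real
  \<comment> \<open>The sets \<open>V t c\<close> are the open sets on which \<open>c\<close> is a lower bound for the weights at all times.\<close>
  define V where "V t c = {x \<in> topspace ?P. s x t \<in> heavy c}" for t c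
  define C where "C = {x \<in> topspace ?P. \<exists>t\<in>{0..1}. card (set_pmf (s x t)) = 2}"
  have sRP: "s x \<in> topspace (RP N)" if "x \<in> topspace ?P" for x
    using continuous_map_image_subset_topspace[OF s] that by blast
  have sB: "s x t \<in> topspace (Bn N)" if "x \<in> topspace ?P" "t \<in> {0..1}" for x t
  proof -
    have "s x \<in> topspace (path_space (Bn N))" using sRP[OF that(1)] unfolding RP_def topspace_subtopology by blast
    then show ?thesis using that(2) by (auto simp: pathin_def continuous_map_def simp del: topspace_Bn)
  qed
  have V_open: "openin ?P (V t c)" if t: "t \<in> {0..1}" and c: "0 \<le> c" for t c
  proof -
    have "continuous_map ?P (path_space (Bn N)) s"
      using s unfolding RP_def by (rule continuous_map_into_fulltopology)
    then have "continuous_map ?P (prod_topology (path_space (Bn N)) (top_of_set {0..1})) (\<lambda>x. (s x, t))"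
      using t by (intro continuous_map_pairedI) auto
    from continuous_map_compose[OF this continuous_map_path_evaluation]
    have "continuous_map ?P (Bn N) (\<lambda>x. s x t)" by (simp add: o_def)
    moreover have "openin (Bn N) (heavy c)" unfolding heavy_def using N c by (rule openin_two_atoms_heavier_than)
    ultimately show ?thesis unfolding V_def by (rule openin_continuous_map_preimage)
  qed
  have C_cover: "\<exists>t\<in>{0..1}. \<exists>c>0. x \<in> V t c" if x: "x \<in> C" for x
  proof -
    obtain t where t: "t \<in> {0..1}" "card (set_pmf (s x t)) = 2" "x \<in> topspace ?P" using x unfolding C_def by blast
    then obtain a b where ab: "set_pmf (s x t) = {a, b}" by (auto simp: card_2_iff)
    let ?c = "min (pmf (s x t) a) (pmf (s x t) b) / 2"
    have "0 < pmf (s x t) a" "0 < pmf (s x t) b" using ab by (auto simp: pmf_positive_iff)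
    then have "0 < ?c" "?c < pmf (s x t) a" "?c < pmf (s x t) b" by (auto simp: min_def)
    then have "x \<in> V t ?c" using t ab sB[OF t(3,1)] by (auto simp: V_def heavy_def simp del: topspace_Bn)
    with t(1) \<open>0 < ?c\<close> show ?thesis by blast
  qed
  have V_sub: "V t c \<subseteq> C" if "t \<in> {0..1}" for t c using that by (auto simp: V_def C_def heavy_def)
  have C_open: "openin ?P C"
    by (subst openin_subopen) (meson C_cover V_open V_sub less_imp_le)
  define A where "A = topspace ?P - C"
  have A_closed: "closedin ?P A" unfolding A_def using C_open by (rule openin_closedin_eq[THEN iffD1, THEN conjunct2])
  let ?\<phi> = "as_pullback ?P (sq_diag m) \<phi>" and ?\<psi> = "as_pullback ?P (sq_diag m) \<psi>"
  have cocycles: "?\<phi> \<in> as_cocycles (Suc p) ?P" "?\<psi> \<in> as_cocycles (Suc q) ?P"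
    using \<phi>(1) \<psi>(1) by (auto intro: as_pullback_cocycle[OF continuous_map_sq_diag])
  have "as_pullback (subtopology ?P A) id ?\<phi> \<in> as_coboundaries (Suc p) (subtopology ?P A)"
  proof (rule sq_diag_pullback_coboundary[OF m s N ends _ \<phi>])
    fix x assume x: "x \<in> topspace (subtopology ?P A)"
    have "1 \<le> pmf (s y t) a" if y: "y \<in> topspace (subtopology ?P A)" and t: "t \<in> {0..1}" and a: "a \<in> set_pmf (s y t)"
      for y t a
    proof -
      have yP: "y \<in> topspace ?P" "card (set_pmf (s y t)) \<noteq> 2" using y t by (auto simp: A_def C_def)
      obtain a' b' where ab: "set_pmf (s y t) = {a', b'}"
        by (rule set_pmf_at_most_two_atoms[OF sB[OF yP(1) t] N]) (rule that)
      then have "a' = b'" using yP(2) by (auto simp: card_2_iff)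
      then have "s y t = return_pmf a" using ab a by (simp add: set_pmf_subset_singleton[symmetric])
      then show ?thesis by simp
    qed
    then show "\<exists>V c. openin (subtopology ?P A) V \<and> x \<in> V \<and> 0 < (c::real) \<and>
        (\<forall>y\<in>V. \<forall>t\<in>{0..1}. \<forall>a\<in>set_pmf (s y t). c \<le> pmf (s y t) a)"
      using x by (intro exI[of _ "topspace (subtopology ?P A)"] exI[of _ 1]) (simp only: openin_topspace, simp)
  qed
  then obtain U where U: "openin ?P U" "A \<subseteq> U"
    "as_pullback (subtopology ?P U) id ?\<phi> \<in> as_coboundaries (Suc p) (subtopology ?P U)"
    by (rule as_coboundary_near_closed_subset[OF metrizable_power_space[OF metrizable_space_euclidean] A_closed cocycles(1)])
      (rule that)
  have "as_pullback (subtopology ?P C) id ?\<psi> \<in> as_coboundaries (Suc q) (subtopology ?P C)"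
  proof (rule sq_diag_pullback_coboundary[OF m s N ends _ \<psi>])
    fix x assume "x \<in> topspace (subtopology ?P C)"
    then have "x \<in> C" by simp
    then obtain t c where tc: "t \<in> {0..1}" "0 < c" "x \<in> V t c" using C_cover by blast
    have "openin (subtopology ?P C) (V t c)"
      using V_open[OF tc(1)] tc(2) V_sub[OF tc(1)] C_open by (simp add: openin_open_subtopology)
    moreover have "c \<le> pmf (s y u) a" if y: "y \<in> V t c" and u: "u \<in> {0..1}" and a: "a \<in> set_pmf (s y u)" for y u a
      using resolvable_path_weights[OF sRP N tc(1) u _ _ a, of c] y by (fastforce simp: V_def heavy_def)
    ultimately show "\<exists>V c. openin (subtopology ?P C) V \<and> x \<in> V \<and> 0 < (c::real) \<and>
        (\<forall>y\<in>V. \<forall>t\<in>{0..1}. \<forall>a\<in>set_pmf (s y t). c \<le> pmf (s y t) a)"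
      using tc(2,3) by blast
  qed
  moreover have "topspace ?P \<subseteq> U \<union> C" using U(2) A_def by blast
  ultimately show ?thesis
    using as_cup_coboundary_if_open_cover[OF U(1) C_open _ cocycles U(3)] by blast
qed

theorem theorem7p15:
  fixes m k1 k2 :: nat
    and \<alpha>1 \<alpha>2 :: "((nat \<Rightarrow> 'a::metric_space uprod) list \<Rightarrow> 'r::ring) set"
  assumes "path_connected_space (euclidean :: 'a topology)"
    and "ANR_space (euclidean :: 'a topology)"
    and "m \<ge> 2" and "k1 \<ge> 1" and "k2 \<ge> 1"
    and "\<alpha>1 \<in> carrier (as_cohomology k1 (power_space m (SP2 euclidean)))"
    and "\<alpha>2 \<in> carrier (as_cohomology k2 (power_space m (SP2 euclidean)))"
    and "as_induced k1 (SP2 euclidean) (diag m) \<alpha>1 = \<one>\<^bsub>as_cohomology k1 (SP2 euclidean)\<^esub>"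
    and "as_induced k2 (SP2 euclidean) (diag m) \<alpha>2 = \<one>\<^bsub>as_cohomology k2 (SP2 euclidean)\<^esub>"
    and "as_cup k1 k2 (power_space m euclidean)
           (as_induced k1 (power_space m euclidean) (sq_diag m) \<alpha>1)
           (as_induced k2 (power_space m euclidean) (sq_diag m) \<alpha>2)
         \<noteq> \<one>\<^bsub>as_cohomology (k1 + k2) (power_space m (euclidean :: 'a topology))\<^esub>"
  shows "iTC TYPE('a) m \<ge> 2"
proof (rule ccontr)
  assume "\<not> 2 \<le> iTC TYPE('a) m"
  then obtain n and s :: "(nat \<Rightarrow> 'a) \<Rightarrow> real \<Rightarrow> 'a pmf" where n: "enat n < 2"
    and s: "continuous_map (power_space m euclidean) (RP (n + 1)) s"
      "\<And>x i. x \<in> topspace (power_space m euclidean) \<Longrightarrow> i \<in> {1..m} \<Longrightarrow>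
        s x ((real i - 1) / (real m - 1)) = return_pmf (x i)"
    unfolding iTC_def not_le Inf_less_iff by blast
  have N: "n + 1 \<le> 2" using n by (simp add: numeral_eq_enat)
  obtain p q where pq: "k1 = Suc p" "k2 = Suc q" using assms(4,5) by (metis Suc_le_D One_nat_def)
  obtain \<phi> where \<phi>: "\<phi> \<in> as_cocycles k1 (power_space m (SP2 euclidean))"
    "\<alpha>1 = as_class k1 (power_space m (SP2 euclidean)) \<phi>" using assms(6) by (auto simp: carrier_as_cohomology)
  obtain \<psi> where \<psi>: "\<psi> \<in> as_cocycles k2 (power_space m (SP2 euclidean))"
    "\<alpha>2 = as_class k2 (power_space m (SP2 euclidean)) \<psi>" using assms(7) by (auto simp: carrier_as_cohomology)
  have "as_pullback (SP2 euclidean) (diag m) \<phi> \<in> as_coboundaries k1 (SP2 euclidean)"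
    "as_pullback (SP2 euclidean) (diag m) \<psi> \<in> as_coboundaries k2 (SP2 euclidean)"
    using assms(8,9) unfolding \<phi>(2) \<psi>(2) as_induced_class[OF continuous_map_diag] one_as_cohomology as_class_eq_one_iff by auto
  then have "as_cochain_cup k1 k2 (as_pullback (power_space m euclidean) (sq_diag m) \<phi>)
      (as_pullback (power_space m euclidean) (sq_diag m) \<psi>)
    \<in> as_coboundaries (k1 + k2) (power_space m (euclidean :: 'a topology))"
    using cup_coboundary_if_resolvable_motion_planner[OF assms(3) s(1) N s(2)] \<phi>(1) \<psi>(1) unfolding pq by blast
  moreover have "as_pullback (power_space m euclidean) (sq_diag m) \<phi> \<in> as_cocycles k1 (power_space m (euclidean :: 'a topology))"
    "as_pullback (power_space m euclidean) (sq_diag m) \<psi> \<in> as_cocycles k2 (power_space m (euclidean :: 'a topology))"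
    using \<phi>(1) \<psi>(1) by (auto intro: as_pullback_cocycle[OF continuous_map_sq_diag])
  ultimately show False
    using assms(10) unfolding \<phi>(2) \<psi>(2) as_induced_class[OF continuous_map_sq_diag] one_as_cohomology
    by (simp add: as_cup_class as_class_eq_one_iff)
qed

end
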